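(* Let $(\mathbb{T},w,x,o)$ be a unimodular Bienaymé-Galton-Watson tree with reproduction law $\pi$, with i.i.d. edge weights of distribution $\omega$ and i.i.d. vertex weights of distribution $\xi$ (all independent), where: (i) $\xi$ is lower bounded, and is either continuous (no atoms) or has its only atom at its minimum $m_\xi\in\mathbb{R}$; (ii) $\omega$ is continuous (no atoms), and its support is locally convex under its maximum $M_\omega\in\mathbb{R}\cup\{+\infty\}$; (iii) $\pi$ has a finite second moment. For a directed edge $(u,v)$ consider the recursion $$Z(u,v)=\max\Big(x(v),\max_{u'\sim v,\ u'\neq u}\big(w(v,u')-Z(v,u')\big)\Big),\qquad(\ast)$$ where the maximum of an empty list is $-\infty$. For $H\in\mathbb{N}_0$ let $\mathbb{T}_H=B_H(\mathbb{T},w,x,o)$ and define families $Z_-^H,Z_+^H$ on the directed edges of $\mathbb{T}$ as follows: set $Z_-^H(u,v)=m_\xi$ (respectively $Z_+^H(u,v)=+\infty$) for every directed edge $(u,v)$ of $\mathbb{T}_H$ pointing towards the boundary, i.e. with $v\in\partial\mathbb{T}_H$; define $Z_-^H$ (respectively $Z_+^H$) on the remaining directed edges of $\mathbb{T}_H$ by recursion $(\ast)$ in $\mathbb{T}_H$; and set both families to an arbitrary value, say $0$, on directed edges outside $\mathbb{T}_H$. Then, $(\mathbb{T},w,x,o)$-almost surely, for every directed edge $\vec e$ of $\mathbb{T}$, $Z_+^H(\vec e)$ and $Z_-^H(\vec e)$ converge as $H\to+\infty$ to a common value $Z(\vec e)$, which is thus $(\mathbb{T},w,x,o)$-measurable.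 Furthermore, $(\mathbb{T},w,x,o)$-almost surely, the only family of messages on the directed edges of $\mathbb{T}$ verifying recursion $(\ast)$ at every directed edge is this common limit $Z$.
   Context: Unimodular Bienaymé-Galton-Watson (UBGW) tree with reproduction law $\pi$: $\pi$ is a probability measure on $\mathbb{N}_0=\{0,1,2,\dots\}$ with finite mean $E>0$; $\hat\pi(k)=\frac{(k+1)\pi(k+1)}{E}$ for $k\in\mathbb{N}_0$. The UBGW tree $(\mathbb{T},o)$ is the random rooted tree in which the numbers of children of all vertices are independent, the root $o$ has a number of children distributed as $\pi$, and every non-root vertex has a number of children distributed as $\hat\pi$. "The support of $\omega$ is locally convex under its maximum $M_\omega$" ($M_\omega$ being the supremum of the support) means that the support contains a non-empty open interval with right endpoint $M_\omega$: $(M_\omega-\varepsilon,M_\omega)$ for some $\varepsilon>0$ if $M_\omega<\infty$, or $(A,+\infty)$ for some $A\in\mathbb{R}$ if $M_\omega=+\infty$. $B_H(\mathbb{T},o)$ is the subtree induced on the vertices at distance at most $H+1$ from $o$ (with restricted weights), and its boundary $\partial\mathbb{T}_H$ is the set of vertices at distance exactly $H+1$ from $o$. The set of directed edges of $\mathbb{T}$ contains both orientations $(u,v)$ and $(v,u)$ of each edge $\{u,v\}$; $w(u,v)=w(v,u)=w(\{u,v\})$. A family of messages is a function from directed edges to $(-\infty,+\infty]$. *)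

theory Defs
  imports "HOL-Probability.Probability"
begin

section \<open>Probability laws\<close>

definition measure_support :: "real measure \<Rightarrow> real set" where
  "measure_support \<mu> = {a. \<forall>U. open U \<longrightarrow> a \<in> U \<longrightarrow> measure \<mu> U > 0}"

definition atomless :: "real measure \<Rightarrow> bool" where
  "atomless \<mu> \<longleftrightarrow> (\<forall>a. measure \<mu> {a} = 0)"

text \<open>The support is closed, so for a lower bounded law this infimum is a minimum.\<close>

definition law_min :: "real measure \<Rightarrow> real" where
  "law_min \<mu> = Inf (measure_support \<mu>)"

definition law_max :: "real measure \<Rightarrow> ereal" where
  "law_max \<mu> = Sup (ereal ` measure_support \<mu>)"

text \<open>One formula for both cases: the interval is \<open>(a, M)\<close> if the maximum \<open>M\<close> is
  finite, and \<open>(a, \<infinity>)\<close> if it is infinite.\<close>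

definition locally_convex_under_max :: "real measure \<Rightarrow> bool" where
  "locally_convex_under_max \<mu> \<longleftrightarrow>
     (\<exists>a::real. ereal a < law_max \<mu> \<and>
        {t. a < t \<and> ereal t < law_max \<mu>} \<subseteq> measure_support \<mu>)"

definition size_biased :: "nat pmf \<Rightarrow> nat pmf" where
  "size_biased \<pi> =
     embed_pmf (\<lambda>k. real (k + 1) * pmf \<pi> (k + 1) / measure_pmf.expectation \<pi> real)"

text \<open>\<^const>\<open>embed_pmf\<close> is only meaningful for a density of total mass one.\<close>

lemma pmf_size_biased:
  assumes int: "integrable (measure_pmf \<pi>) real"
    and pos: "measure_pmf.expectation \<pi> real > 0"
  shows "pmf (size_biased \<pi>) k =
    real (k + 1) * pmf \<pi> (k + 1) / measure_pmf.expectation \<pi> real"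
proof -
  let ?E = "measure_pmf.expectation \<pi> real"
  let ?g = "\<lambda>k. real (k + 1) * pmf \<pi> (k + 1) / ?E"
  have nonneg: "\<And>k. 0 \<le> ?g k"
    using pos by simp
  have "ennreal ?E = (\<integral>\<^sup>+k. ennreal (real k) \<partial>measure_pmf \<pi>)"
    using int by (subst nn_integral_eq_integral) auto
  also have "\<dots> = (\<integral>\<^sup>+k. ennreal (pmf \<pi> k) * ennreal (real k) \<partial>count_space UNIV)"
    by (rule nn_integral_measure_pmf)
  also have "\<dots> = (\<Sum>k. ennreal (pmf \<pi> k) * ennreal (real k))"
    by (rule nn_integral_count_space_nat)
  also have "\<dots> = (\<Sum>k. ennreal (pmf \<pi> (k + 1)) * ennreal (real (k + 1)))"
    by (subst suminf_offset[where i = 1]) auto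
  also have "\<dots> = (\<Sum>k. ennreal ?E * ennreal (?g k))"
    using pos by (intro suminf_cong) (simp add: ennreal_mult[symmetric] mult.commute del: of_nat_Suc of_nat_add)
  also have "\<dots> = ennreal ?E * (\<Sum>k. ennreal (?g k))"
    by (rule ennreal_suminf_cmult)
  finally have eq: "ennreal ?E * 1 = ennreal ?E * (\<Sum>k. ennreal (?g k))"
    by simp
  have "(\<Sum>k. ennreal (?g k)) = 1"
    using eq pos by (subst (asm) ennreal_mult_cancel_left) auto
  then have "(\<integral>\<^sup>+k. ennreal (?g k) \<partial>count_space UNIV) = 1"
    by (simp only: nn_integral_count_space_nat)
  then show ?thesis
    unfolding size_biased_def by (intro pmf_embed_pmf nonneg)
qed


section \<open>Ulam--Harris trees and messages\<close>

text \<open>Vertices are words over the naturals, the root \<open>o\<close> is the empty word, and the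
  children of \<open>v\<close> are the words \<open>v @ [i]\<close> with \<open>i\<close> smaller than the offspring number
  \<open>c v\<close>. The length of a word is its distance to the root.\<close>

type_synonym vertex = "nat list"

definition gw_tree :: "(vertex \<Rightarrow> nat) \<Rightarrow> vertex set" where
  "gw_tree c = {v. \<forall>k<length v. v ! k < c (take k v)}"

definition uh_adjacent :: "vertex \<Rightarrow> vertex \<Rightarrow> bool" where
  "uh_adjacent u v \<longleftrightarrow> (\<exists>i. v = u @ [i] \<or> u = v @ [i])"

definition uh_edges :: "vertex set set" where
  "uh_edges = {{u, v} |u v. uh_adjacent u v}"

definition directed_edges :: "vertex set \<Rightarrow> (vertex \<times> vertex) set" where
  "directed_edges T = {(u, v). u \<in> T \<and> v \<in> T \<and> uh_adjacent u v}"

definition root_ball :: "vertex set \<Rightarrow> nat \<Rightarrow> vertex set" where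
  "root_ball T H = {v \<in> T. length v \<le> H + 1}"

definition ball_boundary :: "vertex set \<Rightarrow> nat \<Rightarrow> vertex set" where
  "ball_boundary T H = {v \<in> T. length v = H + 1}"

text \<open>Right-hand side of the recursion. In \<^typ>\<open>ereal\<close> the supremum of the empty set is
  \<open>-\<infinity>\<close>, and \<open>w - \<infinity> = -\<infinity>\<close> for real \<open>w\<close>; in a locally finite tree the supremum is
  over a finite set.\<close>

definition message_rhs ::
  "vertex set \<Rightarrow> (vertex set \<Rightarrow> real) \<Rightarrow> (vertex \<Rightarrow> real) \<Rightarrow>
   (vertex \<Rightarrow> vertex \<Rightarrow> ereal) \<Rightarrow> vertex \<Rightarrow> vertex \<Rightarrow> ereal" where
  "message_rhs T w x Z u v =
     max (ereal (x v))
       (SUP u' \<in> {u'. (v, u') \<in> directed_edges T \<and> u' \<noteq> u}. ereal (w {v, u'}) - Z v u')"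

lemma message_rhs_cong [fundef_cong]:
  assumes "T = T'" "w = w'" "x = x'" "u = u1" "v = v1"
    and "\<And>u'. (v1, u') \<in> directed_edges T' \<Longrightarrow> u' \<noteq> u1 \<Longrightarrow> Z v1 u' = Z' v1 u'"
  shows "message_rhs T w x Z u v = message_rhs T' w' x' Z' u1 v1"
  using assms unfolding message_rhs_def by (auto intro!: arg_cong2[where f = max] SUP_cong)

text \<open>The family on the directed edges of \<open>T\<close> with value \<open>b\<close> on the edges of the ball that
  point towards its boundary, the recursion inside the ball on its other edges, and \<open>0\<close>
  outside the ball.\<close>

function ball_messages ::
  "vertex set \<Rightarrow> (vertex set \<Rightarrow> real) \<Rightarrow> (vertex \<Rightarrow> real) \<Rightarrow> ereal \<Rightarrow> nat \<Rightarrow>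
   vertex \<Rightarrow> vertex \<Rightarrow> ereal" where
  "ball_messages T w x b H u v =
     (if (u, v) \<notin> directed_edges (root_ball T H) then 0
      else if v \<in> ball_boundary T H then b
      else message_rhs (root_ball T H) w x (\<lambda>v' u'. ball_messages T w x b H v' u') u v)"
  by pat_completeness auto

text \<open>Downward edges only depend on edges further down; upward edges also depend on the
  upward edge one step closer to the root.\<close>

termination
  by (relation "Wellfounded.measure (\<lambda>(T, w, x, b, H, u, v).
        if length u < length v then H + 1 - length v else H + 2 + length v)")
     (auto simp: directed_edges_def root_ball_def ball_boundary_def uh_adjacent_def)

declare ball_messages.simps [simp del]

definition is_message_family :: "vertex set \<Rightarrow> (vertex \<Rightarrow> vertex \<Rightarrow> ereal) \<Rightarrow> bool" where
  "is_message_family T Z \<longleftrightarrow> (\<forall>(u, v) \<in> directed_edges T. Z u v \<noteq> -\<infinity>)"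

definition satisfies_recursion ::
  "vertex set \<Rightarrow> (vertex set \<Rightarrow> real) \<Rightarrow> (vertex \<Rightarrow> real) \<Rightarrow>
   (vertex \<Rightarrow> vertex \<Rightarrow> ereal) \<Rightarrow> bool" where
  "satisfies_recursion T w x Z \<longleftrightarrow>
     (\<forall>(u, v) \<in> directed_edges T. Z u v = message_rhs T w x Z u v)"


section \<open>The weighted unimodular Bienayme--Galton--Watson tree\<close>

text \<open>\<open>N v\<close> is the offspring number of \<open>v\<close>, \<open>w e\<close> the weight of the undirected edge \<open>e\<close>
  and \<open>x v\<close> the weight of \<open>v\<close>. They are sampled on all words and restricted to the tree.
  Joint independence is expressed for one real-valued family, in which the offspring
  numbers are embedded in the reals.\<close>

locale weighted_ubgw = prob_space M
  for M :: "'s measure" +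
  fixes \<pi> :: "nat pmf" and \<omega> \<xi> :: "real measure"
    and N :: "vertex \<Rightarrow> 's \<Rightarrow> nat"
    and w :: "vertex set \<Rightarrow> 's \<Rightarrow> real"
    and x :: "vertex \<Rightarrow> 's \<Rightarrow> real"
  assumes finite_mean: "integrable (measure_pmf \<pi>) real"
    and mean_pos: "measure_pmf.expectation \<pi> real > 0"
    and edge_law: "real_distribution \<omega>"
    and vertex_law: "real_distribution \<xi>"
    and N_root: "N [] \<in> measurable M (count_space UNIV)"
      "distr M (count_space UNIV) (N []) = measure_pmf \<pi>"
    and N_nonroot: "\<And>v. v \<noteq> [] \<Longrightarrow> N v \<in> measurable M (count_space UNIV)"
      "\<And>v. v \<noteq> [] \<Longrightarrow> distr M (count_space UNIV) (N v) = measure_pmf (size_biased \<pi>)"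
    and w_dist: "\<And>e. e \<in> uh_edges \<Longrightarrow> random_variable borel (w e)"
      "\<And>e. e \<in> uh_edges \<Longrightarrow> distr M borel (w e) = \<omega>"
    and x_dist: "\<And>v. random_variable borel (x v)"
      "\<And>v. distr M borel (x v) = \<xi>"
    and independent:
      "indep_vars (\<lambda>_. borel)
         (case_sum (\<lambda>v s. real (N v s)) (case_sum w x))
         (UNIV <+> uh_edges <+> UNIV)"

definition sample_tree :: "(vertex \<Rightarrow> 's \<Rightarrow> nat) \<Rightarrow> 's \<Rightarrow> vertex set" where
  "sample_tree N s = gw_tree (\<lambda>v. N v s)"

text \<open>The sigma-algebra generated by the weighted tree; the weights are only observed on
  vertices and edges of the tree.\<close>

definition weighted_tree_sigma ::
  "'s measure \<Rightarrow> (vertex \<Rightarrow> 's \<Rightarrow> nat) \<Rightarrow> (vertex set \<Rightarrow> 's \<Rightarrow> real) \<Rightarrow>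
   (vertex \<Rightarrow> 's \<Rightarrow> real) \<Rightarrow> 's measure" where
  "weighted_tree_sigma M N w x = sigma (space M)
     ({{s \<in> space M. v \<in> sample_tree N s \<and> x v s \<in> B} |v B. B \<in> sets borel} \<union>
      {{s \<in> space M. (u, v) \<in> directed_edges (sample_tree N s) \<and> w {u, v} s \<in> B} |u v B.
         B \<in> sets borel})"

end

theory Submission
  imports Defs
begin

text \<open>The recursion is antitone, so iterating it from the boundary values gives, at every vertex, an
  increasing lower and a decreasing upper bound whose limits \<open>l \<le> u\<close> are exchanged by one step of
  the recursion; everything reduces to \<open>l = u\<close> almost surely below the root. For an independent edge
  weight \<open>w\<close> and an independent copy \<open>(l', u')\<close>, the probability of \<open>w > l + u'\<close> is symmetric in
  the two bounds. Computing it from the recursion shows that, for an independent vertex weight \<open>x\<close>,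
  \<open>w - l < x\<close> and \<open>w - u < x\<close> are equally likely, so \<open>w\<close> almost surely avoids \<open>(x + l, x + u)\<close>.
  Local convexity of the support of \<open>w\<close> then restricts where \<open>l < u\<close> can happen, and propagating
  extreme values of \<open>l\<close> and \<open>u\<close> through one generation rules it out.\<close>

section \<open>Lower and upper bounds along the tree\<close>

text \<open>One step of the recursion only shows that the laws of \<open>l\<close> and
  \<open>u\<close> are exchanged, which leaves room for a cycle of length two, so a second relation
  is needed. It comes from an edge joining the roots of two independent subtrees: the edge looks the
  same from both ends, so it does not matter at which end the lower bound is read and at which the
  upper one. The order \<open>l \<le> u\<close> then turns an equality of expectations into an
  almost sure equality. Vertex weights close to the minimum \<open>m\<close> of \<xi> serve twice:
  they place the avoided interval at \<open>(m + l, m + u)\<close>, and in the last argument they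
  keep the vertex weight from hiding what the children contribute. Only vertices below the root are
  treated with probability: their offspring numbers share one law, so the subtree of a child is
  distributed like that of its parent. Messages towards the root need no further probability, since
  they are determined by the downward ones, by induction on the depth.\<close>

text \<open>\<open>bnd c w x m True n\<close> increases and \<open>bnd c w x m False n\<close> decreases in \<open>n\<close>. The recursion is
  antitone, so one step exchanges the two.\<close>

fun bnd :: "(vertex \<Rightarrow> nat) \<Rightarrow> (vertex \<Rightarrow> nat \<Rightarrow> real) \<Rightarrow> (vertex \<Rightarrow> real) \<Rightarrow> real \<Rightarrow> bool \<Rightarrow>
    nat \<Rightarrow> vertex \<Rightarrow> ereal" where
  "bnd c w x m lower 0 v = (if lower then ereal m else \<infinity>)"
| "bnd c w x m lower (Suc n) v =
     max (ereal (x v)) (SUP i\<in>{..<c v}. ereal (w v i) - bnd c w x m (\<not> lower) n (v @ [i]))"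

lemma bnd_shift:
  "bnd c w x m b n (u @ v) = bnd (\<lambda>y. c (u @ y)) (\<lambda>y. w (u @ y)) (\<lambda>y. x (u @ y)) m b n v"
  by (induction n arbitrary: b v) auto

lemma ereal_diff_antimono: "a \<le> b \<Longrightarrow> ereal r - b \<le> ereal r - a"
  by (rule ereal_minus_mono) auto

lemma bnd_step_mono:
  assumes "\<And>i. i < c v \<Longrightarrow> bnd c w x m (\<not> b) n (v @ [i]) \<le> bnd c w x m (\<not> b') n' (v @ [i])"
  shows "bnd c w x m b' (Suc n') v \<le> bnd c w x m b (Suc n) v"
  unfolding bnd.simps using assms
  by (intro max.mono order_refl SUP_subset_mono ereal_diff_antimono) auto

text \<open>Each step turns the monotonicity of one family into that of the other, so the claims are
  proved together. The hypothesis starts the induction: every value of the recursion is at least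
  \<open>m\<close>.\<close>

lemma bnd_mono:
  assumes m: "\<And>v. m \<le> x v"
  shows "bnd c w x m True n v \<le> bnd c w x m True (Suc n) v
    \<and> bnd c w x m False (Suc n) v \<le> bnd c w x m False n v
    \<and> bnd c w x m True n v \<le> bnd c w x m False n v"
proof (induction n arbitrary: v)
  case 0
  show ?case using m by (auto simp: le_max_iff_disj)
next
  case (Suc n)
  show ?case
    using Suc.IH by (intro conjI bnd_step_mono) (simp_all del: bnd.simps)
qed

lemma finite_SUP_tendsto_ereal:
  fixes f :: "nat \<Rightarrow> 'a \<Rightarrow> ereal"
  assumes "finite A" "\<And>a. a \<in> A \<Longrightarrow> (\<lambda>n. f n a) \<longlonglongrightarrow> g a"
  shows "(\<lambda>n. SUP a\<in>A. f n a) \<longlonglongrightarrow> (SUP a\<in>A. g a)"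
  using assms
proof (induction A rule: finite_induct)
  case empty
  then show ?case by simp
next
  case (insert a A)
  then show ?case
    by (auto simp: sup_max intro!: tendsto_max)
qed

text \<open>The minuend is real, so the limit may be infinite without
  \<open>\<infinity> - \<infinity>\<close> arising.\<close>

lemma tendsto_ereal_minus_real:
  assumes "f \<longlonglongrightarrow> z"
  shows "(\<lambda>n. ereal r - f n) \<longlonglongrightarrow> ereal r - z"
proof -
  have "(\<lambda>n. ereal r + (- f n)) \<longlonglongrightarrow> ereal r + (- z)"
    using assms by (intro tendsto_add_ereal_general) auto
  then show ?thesis by (simp add: minus_ereal_def)
qed

definition lower_limit where
  "lower_limit c w x m v = (SUP n. bnd c w x m True n v)"

definition upper_limit where
  "upper_limit c w x m v = (INF n. bnd c w x m False n v)"

lemma bnd_tendsto: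
  assumes m: "\<And>v. m \<le> x v"
  shows bnd_tendsto_lower: "(\<lambda>n. bnd c w x m True n v) \<longlonglongrightarrow> lower_limit c w x m v"
    and bnd_tendsto_upper: "(\<lambda>n. bnd c w x m False n v) \<longlonglongrightarrow> upper_limit c w x m v"
  unfolding lower_limit_def upper_limit_def
  using bnd_mono[of m x, OF m]
  by (auto intro!: LIMSEQ_SUP LIMSEQ_INF incseq_SucI decseq_SucI simp del: bnd.simps)

lemma lower_limit_shift:
  "lower_limit c w x m (u @ v) =
    lower_limit (\<lambda>y. c (u @ y)) (\<lambda>y. w (u @ y)) (\<lambda>y. x (u @ y)) m v"
  by (simp add: lower_limit_def bnd_shift)

lemma upper_limit_shift:
  "upper_limit c w x m (u @ v) =
    upper_limit (\<lambda>y. c (u @ y)) (\<lambda>y. w (u @ y)) (\<lambda>y. x (u @ y)) m v"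
  by (simp add: upper_limit_def bnd_shift)

lemma limits_bounds:
  assumes m: "\<And>v. m \<le> x v"
  shows "ereal m \<le> lower_limit c w x m v"
    and "lower_limit c w x m v \<le> upper_limit c w x m v"
    and "upper_limit c w x m v < \<infinity>"
proof -
  have "bnd c w x m True 0 v \<le> lower_limit c w x m v"
    unfolding lower_limit_def by (rule SUP_upper) simp
  then show "ereal m \<le> lower_limit c w x m v" by simp
  show "lower_limit c w x m v \<le> upper_limit c w x m v"
    using bnd_mono[of m x, OF m]
    by (intro LIMSEQ_le[OF bnd_tendsto_lower bnd_tendsto_upper]) (auto simp del: bnd.simps intro: m)
  \<comment> \<open>One step removes the initial value \<open>\<infinity>\<close>: the children
    enter through the lower bound \<open>m\<close>, and there are finitely many.\<close>
  have "upper_limit c w x m v \<le> bnd c w x m False (Suc 0) v"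
    unfolding upper_limit_def by (rule INF_lower) simp
  also have "\<dots> \<le> ereal (Max (insert (x v) ((\<lambda>i. w v i - m) ` {..<c v})))"
    by (auto intro!: SUP_least Max_ge)
  finally show "upper_limit c w x m v < \<infinity>"
    by (auto simp: less_top[symmetric])
qed

text \<open>The recursion is continuous because its maximum has finitely many terms. Being exchanged
  does not make the limits equal: on an infinite path with vertex weights 0, edge weights 1 and
  \<open>m = 0\<close> they are 0 and 1.\<close>

lemma limits_fixed_point:
  assumes m: "\<And>v. m \<le> x v"
  shows "lower_limit c w x m v =
      max (ereal (x v)) (SUP i\<in>{..<c v}. ereal (w v i) - upper_limit c w x m (v @ [i]))"
    and "upper_limit c w x m v =
      max (ereal (x v)) (SUP i\<in>{..<c v}. ereal (w v i) - lower_limit c w x m (v @ [i]))"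
proof -
  have "(\<lambda>n. bnd c w x m True (Suc n) v) \<longlonglongrightarrow>
      max (ereal (x v)) (SUP i\<in>{..<c v}. ereal (w v i) - upper_limit c w x m (v @ [i]))"
    using bnd_tendsto_upper[of m x, OF m]
    by (auto intro!: tendsto_max finite_SUP_tendsto_ereal tendsto_ereal_minus_real)
  with LIMSEQ_Suc[OF bnd_tendsto_lower[of m x, OF m]]
  show "lower_limit c w x m v =
      max (ereal (x v)) (SUP i\<in>{..<c v}. ereal (w v i) - upper_limit c w x m (v @ [i]))"
    by (rule LIMSEQ_unique)
  have "(\<lambda>n. bnd c w x m False (Suc n) v) \<longlonglongrightarrow>
      max (ereal (x v)) (SUP i\<in>{..<c v}. ereal (w v i) - lower_limit c w x m (v @ [i]))"
    using bnd_tendsto_lower[of m x, OF m]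
    by (auto intro!: tendsto_max finite_SUP_tendsto_ereal tendsto_ereal_minus_real)
  with LIMSEQ_Suc[OF bnd_tendsto_upper[of m x, OF m]]
  show "upper_limit c w x m v =
      max (ereal (x v)) (SUP i\<in>{..<c v}. ereal (w v i) - lower_limit c w x m (v @ [i]))"
    by (rule LIMSEQ_unique)
qed


section \<open>Messages on a fixed tree\<close>

lemma gw_tree_snoc: "v @ [i] \<in> gw_tree c \<longleftrightarrow> v \<in> gw_tree c \<and> i < c v"
  by (auto simp: gw_tree_def nth_append less_Suc_eq)

lemma gw_tree_snoc_snoc: "v @ [j, i] \<in> gw_tree c \<longleftrightarrow> v @ [j] \<in> gw_tree c \<and> i < c (v @ [j])"
  using gw_tree_snoc[of "v @ [j]" i c] by simp

lemma directed_edges_gw_tree_cases: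
  assumes "(u, v) \<in> directed_edges (gw_tree c)"
  obtains (down) i where "v = u @ [i]" "u \<in> gw_tree c" "i < c u"
  | (up) i where "u = v @ [i]" "v \<in> gw_tree c" "i < c v"
  using assms by (auto simp: directed_edges_def uh_adjacent_def gw_tree_snoc)

lemma directed_edges_down_iff:
  "(v, v @ [i]) \<in> directed_edges (gw_tree c) \<longleftrightarrow> v \<in> gw_tree c \<and> i < c v"
  by (auto simp: directed_edges_def uh_adjacent_def gw_tree_snoc)

lemma directed_edges_snoc_iff:
  "(v @ [j], v @ [j, i]) \<in> directed_edges (gw_tree c) \<longleftrightarrow> v @ [j] \<in> gw_tree c \<and> i < c (v @ [j])"
  using directed_edges_down_iff[of "v @ [j]" i c] by simp

lemma finite_neighbours: "finite {u'. (v, u') \<in> directed_edges (gw_tree c)}"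
proof (rule finite_subset)
  show "{u'. (v, u') \<in> directed_edges (gw_tree c)} \<subseteq> insert (butlast v) ((\<lambda>i. v @ [i]) ` {..<c v})"
    by (auto elim: directed_edges_gw_tree_cases)
qed simp

lemma message_rhs_down:
  assumes "v = u @ [j]" "v \<in> gw_tree c"
  shows "message_rhs (gw_tree c) w x Z u v =
    max (ereal (x v)) (SUP i\<in>{..<c v}. ereal (w {v, v @ [i]}) - Z v (v @ [i]))"
proof -
  have "{u'. (v, u') \<in> directed_edges (gw_tree c) \<and> u' \<noteq> u} = (\<lambda>i. v @ [i]) ` {..<c v}"
    using assms by (auto elim!: directed_edges_gw_tree_cases simp: directed_edges_snoc_iff)
  then show ?thesis
    by (simp add: message_rhs_def image_image)
qed

lemma message_rhs_tendsto:
  assumes "\<And>u'. (v, u') \<in> directed_edges (gw_tree c) \<Longrightarrow> u' \<noteq> u \<Longrightarrow> (\<lambda>n. f n v u') \<longlonglongrightarrow> Z v u'"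
  shows "(\<lambda>n. message_rhs (gw_tree c) w x (f n) u v) \<longlonglongrightarrow> message_rhs (gw_tree c) w x Z u v"
  unfolding message_rhs_def
  using assms finite_neighbours[of v c]
  by (auto intro!: tendsto_max finite_SUP_tendsto_ereal tendsto_ereal_minus_real)

section \<open>Messages on a finite ball\<close>

lemma directed_edges_root_ball:
  "(u, v) \<in> directed_edges (root_ball T H) \<longleftrightarrow>
    (u, v) \<in> directed_edges T \<and> length u \<le> H + 1 \<and> length v \<le> H + 1"
  by (auto simp: directed_edges_def root_ball_def)

text \<open>The ball has radius \<open>H + 1\<close>, so it contains all neighbours of a vertex of
  depth at most \<open>H\<close>, and the recursion in the ball is the recursion in the tree
  there.\<close>

lemma ball_messages_rec:
  assumes "(u, v) \<in> directed_edges T" "length v \<le> H" "length u \<le> H + 1"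
  shows "ball_messages T w x b H u v = message_rhs T w x (ball_messages T w x b H) u v"
proof -
  have "{u'. (v, u') \<in> directed_edges (root_ball T H) \<and> u' \<noteq> u} =
      {u'. (v, u') \<in> directed_edges T \<and> u' \<noteq> u}"
    using assms(2) by (auto simp: directed_edges_root_ball) (auto simp: directed_edges_def uh_adjacent_def)
  then have "message_rhs (root_ball T H) w x Z u v = message_rhs T w x Z u v" for Z
    by (simp add: message_rhs_def)
  then show ?thesis
    using assms by (subst ball_messages.simps) (auto simp: directed_edges_root_ball ball_boundary_def)
qed

lemma ball_messages_boundary:
  assumes "(u, v) \<in> directed_edges T" "length v = H + 1" "length u \<le> H + 1"
  shows "ball_messages T w x b H u v = b"
  using assms
  by (subst ball_messages.simps, simp only: directed_edges_root_ball)
    (simp add: ball_boundary_def directed_edges_def)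

text \<open>The parity of the distance to the boundary decides whether a boundary value gives a lower
  or an upper bound.\<close>

lemma ball_messages_down:
  assumes "u @ [j] \<in> gw_tree c" "length u + 1 + n = H + 1"
  shows "ball_messages (gw_tree c) w x (if b then ereal m else \<infinity>) H u (u @ [j]) =
    bnd c (\<lambda>v i. w {v, v @ [i]}) x m (b = even n) n (u @ [j])"
  using assms
proof (induction n arbitrary: u j)
  case 0
  then show ?case
    by (subst ball_messages_boundary) (auto simp: directed_edges_down_iff gw_tree_snoc)
next
  case (Suc n)
  have "ball_messages (gw_tree c) w x (if b then ereal m else \<infinity>) H (u @ [j]) ((u @ [j]) @ [i]) =
    bnd c (\<lambda>v i. w {v, v @ [i]}) x m (b = even n) n ((u @ [j]) @ [i])" if "i < c (u @ [j])" for i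
    using Suc.prems that by (intro Suc.IH) (auto simp: gw_tree_snoc_snoc)
  moreover have "(\<not> (b \<longleftrightarrow> odd n)) = (b \<longleftrightarrow> even n)"
    by auto
  ultimately show ?case
    using Suc.prems
    by (subst ball_messages_rec)
      (auto simp: directed_edges_down_iff gw_tree_snoc message_rhs_down[OF refl])
qed

text \<open>The limit inferior is defined for every tree and preserves measurability, so the limit
  is measurable on the whole sample space and not only where the messages converge.\<close>

definition ball_limit ::
  "vertex set \<Rightarrow> (vertex set \<Rightarrow> real) \<Rightarrow> (vertex \<Rightarrow> real) \<Rightarrow> vertex \<Rightarrow> vertex \<Rightarrow> ereal" where
  "ball_limit T w x u v = liminf (\<lambda>H. ball_messages T w x \<infinity> H u v)"

text \<open>The root is left out: it is the head of no downward edge, and its offspring number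
  follows a different law.\<close>

locale coinciding_bounds =
  fixes c :: "vertex \<Rightarrow> nat" and w :: "vertex set \<Rightarrow> real" and x :: "vertex \<Rightarrow> real" and m :: real
  assumes m_le: "\<And>v. m \<le> x v"
    and coincide: "\<And>v. v \<noteq> [] \<Longrightarrow>
      lower_limit c (\<lambda>v i. w {v, v @ [i]}) x m v = upper_limit c (\<lambda>v i. w {v, v @ [i]}) x m v"
begin

abbreviation "T \<equiv> gw_tree c"
abbreviation "we \<equiv> \<lambda>v i. w {v, v @ [i]}"

text \<open>For a fixed boundary value the terms alternate between lower and upper bounds, so
  convergence depends on the two limits being equal.\<close>

lemma bnd_tendsto_common:
  assumes "v \<noteq> []"
  shows "(\<lambda>n. bnd c we x m (b = even n) n v) \<longlonglongrightarrow> lower_limit c we x m v"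
proof -
  have l: "(\<lambda>n. bnd c we x m True n v) \<longlonglongrightarrow> lower_limit c we x m v"
    by (rule bnd_tendsto_lower) (rule m_le)
  have u: "(\<lambda>n. bnd c we x m False n v) \<longlonglongrightarrow> lower_limit c we x m v"
    unfolding coincide[OF assms] by (rule bnd_tendsto_upper) (rule m_le)
  have le: "bnd c we x m True n v \<le> bnd c we x m b' n v \<and> bnd c we x m b' n v \<le> bnd c we x m False n v"
    for b' n
    using bnd_mono[of m x, OF m_le] by (cases b') auto
  show ?thesis
  proof (rule tendsto_sandwich[OF _ _ l u])
    show "\<forall>\<^sub>F n in sequentially. bnd c we x m True n v \<le> bnd c we x m (b = even n) n v"
      using le by (intro always_eventually) auto
    show "\<forall>\<^sub>F n in sequentially. bnd c we x m (b = even n) n v \<le> bnd c we x m False n v"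
      using le by (intro always_eventually) auto
  qed
qed

lemma ball_messages_down_tendsto:
  assumes "u @ [j] \<in> T"
  shows "(\<lambda>H. ball_messages T w x (if b then ereal m else \<infinity>) H u (u @ [j]))
    \<longlonglongrightarrow> lower_limit c we x m (u @ [j])"
proof -
  \<comment> \<open>The vertex \<open>u @ [j]\<close> is \<open>n\<close> steps away from the
    boundary exactly when \<open>H = n + length u\<close>.\<close>
  have "(\<lambda>n. ball_messages T w x (if b then ereal m else \<infinity>) (n + length u) u (u @ [j]))
      \<longlonglongrightarrow> lower_limit c we x m (u @ [j])"
    using bnd_tendsto_common[of "u @ [j]" b] assms by (simp add: ball_messages_down)
  then show ?thesis by (rule LIMSEQ_offset)
qed

text \<open>Induction along the path to the root: an upward message depends on downward messages,
  whose limits are known, and on the upward message one step closer to the root. Choosing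
  \<open>z\<close> before \<open>b\<close> gives the same limit for both boundary values.\<close>

lemma ball_messages_up_tendsto:
  assumes "v @ [i] \<in> T"
  shows "\<exists>z. \<forall>b. (\<lambda>H. ball_messages T w x (if b then ereal m else \<infinity>) H (v @ [i]) v) \<longlonglongrightarrow> z"
  using assms
proof (induction v arbitrary: i rule: rev_induct)
  case Nil
  define Z where "Z = (\<lambda>(v :: vertex) u'. lower_limit c we x m u')"
  have "(\<lambda>H. message_rhs T w x (ball_messages T w x (if b then ereal m else \<infinity>) H) [i] [])
      \<longlonglongrightarrow> message_rhs T w x Z [i] []" for b
    using ball_messages_down_tendsto[of "[]" _ b]
    by (intro message_rhs_tendsto) (auto elim!: directed_edges_gw_tree_cases simp: Z_def gw_tree_snoc[of "[]", simplified])
  moreover have "eventually (\<lambda>H. message_rhs T w x (ball_messages T w x (if b then ereal m else \<infinity>) H) [i] [] =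
     ball_messages T w x (if b then ereal m else \<infinity>) H [i] []) sequentially" for b
    using Nil by (intro always_eventually allI ball_messages_rec[symmetric])
      (auto simp: directed_edges_def uh_adjacent_def gw_tree_def)
  ultimately have "\<forall>b. (\<lambda>H. ball_messages T w x (if b then ereal m else \<infinity>) H [i] [])
      \<longlonglongrightarrow> message_rhs T w x Z [i] []"
    by (blast intro: Lim_transform_eventually)
  then show ?case unfolding append_Nil by blast
next
  case (snoc j v)
  from snoc.prems have vj: "v @ [j] \<in> T" and v: "v \<in> T"
    using gw_tree_snoc[of "v @ [j]" i c] gw_tree_snoc[of v j c] by auto
  from snoc.IH[OF vj] obtain z where z:
    "\<And>b. (\<lambda>H. ball_messages T w x (if b then ereal m else \<infinity>) H (v @ [j]) v) \<longlonglongrightarrow> z"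
    by blast
  define Z where "Z = (\<lambda>(v' :: vertex) u'. if u' = v then z else lower_limit c we x m u')"
  have "(\<lambda>H. message_rhs T w x (ball_messages T w x (if b then ereal m else \<infinity>) H) ((v @ [j]) @ [i]) (v @ [j]))
      \<longlonglongrightarrow> message_rhs T w x Z ((v @ [j]) @ [i]) (v @ [j])" for b
  proof (rule message_rhs_tendsto)
    fix u' assume u': "(v @ [j], u') \<in> directed_edges T"
    then show "(\<lambda>H. ball_messages T w x (if b then ereal m else \<infinity>) H (v @ [j]) u') \<longlonglongrightarrow> Z (v @ [j]) u'"
    proof (cases rule: directed_edges_gw_tree_cases)
      case (down k)
      then have "u' \<noteq> v" by auto
      then show ?thesis
        using ball_messages_down_tendsto[of "v @ [j]" k b] down
        by (auto simp: Z_def gw_tree_snoc_snoc)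
    next
      case (up k)
      then show ?thesis using z by (auto simp: Z_def)
    qed
  qed
  moreover have "eventually (\<lambda>H. message_rhs T w x (ball_messages T w x (if b then ereal m else \<infinity>) H) ((v @ [j]) @ [i]) (v @ [j]) =
     ball_messages T w x (if b then ereal m else \<infinity>) H ((v @ [j]) @ [i]) (v @ [j])) sequentially" for b
    using eventually_ge_at_top[of "length v + 2"]
  proof eventually_elim
    case (elim H)
    then show ?case
      using snoc.prems vj
      by (intro ball_messages_rec[symmetric]) (auto simp: directed_edges_def uh_adjacent_def)
  qed
  ultimately have "\<forall>b. (\<lambda>H. ball_messages T w x (if b then ereal m else \<infinity>) H ((v @ [j]) @ [i]) (v @ [j]))
      \<longlonglongrightarrow> message_rhs T w x Z ((v @ [j]) @ [i]) (v @ [j])"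
    by (blast intro: Lim_transform_eventually)
  then show ?case by blast
qed

lemma ball_messages_tendsto:
  assumes "(u, v) \<in> directed_edges T"
  shows "(\<lambda>H. ball_messages T w x (if b then ereal m else \<infinity>) H u v) \<longlonglongrightarrow> ball_limit T w x u v"
proof -
  obtain z where z: "\<And>b. (\<lambda>H. ball_messages T w x (if b then ereal m else \<infinity>) H u v) \<longlonglongrightarrow> z"
    using assms
  proof (cases rule: directed_edges_gw_tree_cases)
    case (down i)
    then show ?thesis
      using ball_messages_down_tendsto[of u i] that by (auto simp: gw_tree_snoc)
  next
    case (up i)
    then show ?thesis
      using ball_messages_up_tendsto[of v i] that by (auto simp: gw_tree_snoc)
  qed
  have "ball_limit T w x u v = z"
    unfolding ball_limit_def using z[of False] by (intro lim_imp_Liminf) auto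
  with z show ?thesis by simp
qed

lemma ball_limit_down:
  assumes "u @ [j] \<in> T"
  shows "ball_limit T w x u (u @ [j]) = lower_limit c we x m (u @ [j])"
  using LIMSEQ_unique[OF ball_messages_tendsto[of u "u @ [j]" True] ball_messages_down_tendsto[OF assms, of True]]
    assms by (auto simp: directed_edges_down_iff gw_tree_snoc)

lemma ball_limit_satisfies_recursion: "satisfies_recursion T w x (ball_limit T w x)"
proof -
  have "ball_limit T w x u v = message_rhs T w x (ball_limit T w x) u v"
    if uv: "(u, v) \<in> directed_edges T" for u v
  proof (rule LIMSEQ_unique)
    show "(\<lambda>H. ball_messages T w x \<infinity> H u v) \<longlonglongrightarrow> ball_limit T w x u v"
      using ball_messages_tendsto[OF uv, of False] by simp
    have "(\<lambda>H. message_rhs T w x (ball_messages T w x \<infinity> H) u v)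
        \<longlonglongrightarrow> message_rhs T w x (ball_limit T w x) u v"
      using ball_messages_tendsto[of _ _ False] by (intro message_rhs_tendsto) simp
    moreover have "eventually (\<lambda>H. message_rhs T w x (ball_messages T w x \<infinity> H) u v =
        ball_messages T w x \<infinity> H u v) sequentially"
      using eventually_ge_at_top[of "length u + length v"]
      by eventually_elim (rule ball_messages_rec[OF uv, symmetric], auto)
    ultimately show "(\<lambda>H. ball_messages T w x \<infinity> H u v)
        \<longlonglongrightarrow> message_rhs T w x (ball_limit T w x) u v"
      by (rule Lim_transform_eventually)
  qed
  then show ?thesis by (auto simp: satisfies_recursion_def)
qed

lemma satisfies_recursion_ge:
  assumes "satisfies_recursion T w x Y" "(u, v) \<in> directed_edges T"
  shows "ereal (x v) \<le> Y u v"
proof -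
  have "Y u v = message_rhs T w x Y u v"
    using assms by (auto simp: satisfies_recursion_def)
  then show ?thesis by (simp add: message_rhs_def)
qed

text \<open>A solution is at least \<open>x\<close>, hence lies between \<open>m\<close> and
  \<open>\<infinity>\<close>; applying the antitone recursion \<open>n\<close> times to this
  enclosure narrows it to the bounds of level \<open>n\<close>.\<close>

lemma bnd_sandwich:
  assumes Y: "satisfies_recursion T w x Y" and "u @ [j] \<in> T"
  shows "bnd c we x m True n (u @ [j]) \<le> Y u (u @ [j])
    \<and> Y u (u @ [j]) \<le> bnd c we x m False n (u @ [j])"
  using assms(2)
proof (induction n arbitrary: u j)
  case 0
  have "ereal m \<le> ereal (x (u @ [j]))"
    using m_le by simp
  also have "\<dots> \<le> Y u (u @ [j])"
    using 0 Y by (intro satisfies_recursion_ge) (auto simp: directed_edges_down_iff gw_tree_snoc)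
  finally show ?case by simp
next
  case (Suc n)
  define v where "v = u @ [j]"
  have "(u, v) \<in> directed_edges T"
    using Suc.prems by (auto simp: v_def directed_edges_down_iff gw_tree_snoc)
  then have "Y u v = message_rhs T w x Y u v"
    using Y by (auto simp: satisfies_recursion_def)
  moreover have "v \<in> T"
    using Suc.prems by (simp add: v_def)
  ultimately have eq: "Y u v = max (ereal (x v)) (SUP i\<in>{..<c v}. ereal (we v i) - Y v (v @ [i]))"
    by (simp only: message_rhs_down[OF v_def])
  have IH: "bnd c we x m True n (v @ [i]) \<le> Y v (v @ [i])"
     "Y v (v @ [i]) \<le> bnd c we x m False n (v @ [i])" if "i < c v" for i
    using Suc.IH[of v i] Suc.prems that by (auto simp: v_def gw_tree_snoc_snoc)
  show ?case
    unfolding v_def[symmetric] eq bnd.simps using IH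
    by (intro conjI max.mono order_refl SUP_subset_mono ereal_diff_antimono) auto
qed

text \<open>Downward messages are squeezed between equal limits. The recursion then determines the
  upward messages, by induction on the depth.\<close>

lemma satisfies_recursion_unique:
  assumes Y: "satisfies_recursion T w x Y" and uv: "(u, v) \<in> directed_edges T"
  shows "Y u v = ball_limit T w x u v"
proof -
  have down: "Y u (u @ [j]) = ball_limit T w x u (u @ [j])" if "u @ [j] \<in> T" for u j
  proof -
    have "lower_limit c we x m (u @ [j]) \<le> Y u (u @ [j])"
      "Y u (u @ [j]) \<le> upper_limit c we x m (u @ [j])"
      using bnd_sandwich[OF Y that]
      by (auto simp: lower_limit_def upper_limit_def intro: SUP_least INF_greatest)
    then show ?thesis
      using coincide[of "u @ [j]"] by (simp add: ball_limit_down[OF that])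
  qed
  have up: "Y (v @ [i]) v = ball_limit T w x (v @ [i]) v" if "v @ [i] \<in> T" for v i
    using that
  proof (induction "length v" arbitrary: v i rule: less_induct)
    case less
    have e: "(v @ [i], v) \<in> directed_edges T"
      using less.prems by (auto simp: directed_edges_def uh_adjacent_def gw_tree_snoc)
    have "Y (v @ [i]) v = message_rhs T w x Y (v @ [i]) v"
      using Y e by (auto simp: satisfies_recursion_def)
    also have "\<dots> = message_rhs T w x (ball_limit T w x) (v @ [i]) v"
    proof (rule message_rhs_cong)
      fix u' assume "(v, u') \<in> directed_edges T"
      then show "Y v u' = ball_limit T w x v u'"
      proof (cases rule: directed_edges_gw_tree_cases)
        case (down k)
        then show ?thesis using \<open>\<And>u j. u @ [j] \<in> T \<Longrightarrow> _\<close> by (auto simp: gw_tree_snoc)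
      next
        case (up k)
        then show ?thesis using less.hyps[of u' k] by (auto simp: gw_tree_snoc)
      qed
    qed auto
    also have "\<dots> = ball_limit T w x (v @ [i]) v"
      using ball_limit_satisfies_recursion e by (auto simp: satisfies_recursion_def)
    finally show ?case .
  qed
  from uv show ?thesis
    by (cases rule: directed_edges_gw_tree_cases) (auto intro: up down simp: gw_tree_snoc)
qed

lemma ball_limit_is_message_family: "is_message_family T (ball_limit T w x)"
  using satisfies_recursion_ge[OF ball_limit_satisfies_recursion]
  by (fastforce simp: is_message_family_def)

end


section \<open>Measurability of the limit\<close>

text \<open>The maximum in the recursion has a random index set. Padding with
  \<open>- \<infinity>\<close> makes it a supremum over a whole type, countable in the applications,
  so that measurability passes through it.\<close>

lemma SUP_Collect_ereal:
  fixes f :: "'b \<Rightarrow> ereal"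
  shows "(SUP a\<in>{a. P a}. f a) = (SUP a. if P a then f a else - \<infinity>)"
proof (rule antisym)
  show "(SUP a\<in>{a. P a}. f a) \<le> (SUP a. if P a then f a else - \<infinity>)"
    by (rule SUP_mono) (metis UNIV_I mem_Collect_eq order_refl)
  show "(SUP a. if P a then f a else - \<infinity>) \<le> (SUP a\<in>{a. P a}. f a)"
    by (rule SUP_least) (auto intro: SUP_upper)
qed

context
  fixes M :: "'s measure" and N :: "vertex \<Rightarrow> 's \<Rightarrow> nat" and w :: "vertex set \<Rightarrow> 's \<Rightarrow> real"
    and x :: "vertex \<Rightarrow> 's \<Rightarrow> real"
begin

abbreviation (input) "\<Sigma> \<equiv> weighted_tree_sigma M N w x"

lemma space_weighted_tree_sigma: "space \<Sigma> = space M"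
  by (simp add: weighted_tree_sigma_def space_measure_of_conv)

text \<open>The sigma-algebra sees a weight only on the event that its vertex belongs to the tree,
  hence the masking.\<close>

lemma measurable_vertex_weight:
  "(\<lambda>s. if v \<in> sample_tree N s then ereal (x v s) else - \<infinity>) \<in> borel_measurable \<Sigma>"
proof -
  have pre: "{s \<in> space M. v \<in> sample_tree N s \<and> x v s \<in> B} \<in> sets \<Sigma>" if "B \<in> sets borel" for B
    unfolding weighted_tree_sigma_def using that by (subst sets_measure_of) (auto intro!: sigma_sets.Basic)
  have t: "{s \<in> space \<Sigma>. v \<in> sample_tree N s} \<in> sets \<Sigma>"
    using pre[of UNIV] by (simp add: space_weighted_tree_sigma)
  have "(\<lambda>s. if v \<in> sample_tree N s then x v s else 0) \<in> borel_measurable \<Sigma>"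
  proof (rule measurableI)
    fix B :: "real set" assume "B \<in> sets borel"
    have "(\<lambda>s. if v \<in> sample_tree N s then x v s else 0) -` B \<inter> space \<Sigma> =
      {s \<in> space M. v \<in> sample_tree N s \<and> x v s \<in> B} \<union>
      (if 0 \<in> B then space \<Sigma> - {s \<in> space \<Sigma>. v \<in> sample_tree N s} else {})"
      by (auto simp: space_weighted_tree_sigma split: if_splits)
    also have "\<dots> \<in> sets \<Sigma>"
      using pre[OF \<open>B \<in> sets borel\<close>] t by auto
    finally show "(\<lambda>s. if v \<in> sample_tree N s then x v s else 0) -` B \<inter> space \<Sigma> \<in> sets \<Sigma>" .
  qed simp
  then have "(\<lambda>s. if v \<in> sample_tree N s then ereal (if v \<in> sample_tree N s then x v s else 0) else - \<infinity>)
      \<in> borel_measurable \<Sigma>"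
    using t by (intro measurable_If) auto
  then show ?thesis by (simp cong: if_cong)
qed

lemma
  shows sets_edge: "{s \<in> space \<Sigma>. (u, v) \<in> directed_edges (sample_tree N s)} \<in> sets \<Sigma>"
    and measurable_edge_weight:
      "(\<lambda>s. if (u, v) \<in> directed_edges (sample_tree N s) then w {u, v} s else 0) \<in> borel_measurable \<Sigma>"
proof -
  let ?E = "\<lambda>s. (u, v) \<in> directed_edges (sample_tree N s)"
  have pre: "{s \<in> space M. ?E s \<and> w {u, v} s \<in> B} \<in> sets \<Sigma>" if "B \<in> sets borel" for B
    unfolding weighted_tree_sigma_def using that
    by (subst sets_measure_of) (auto intro!: sigma_sets.Basic)
  show t: "{s \<in> space \<Sigma>. ?E s} \<in> sets \<Sigma>"
    using pre[of UNIV] by (simp add: space_weighted_tree_sigma)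
  show "(\<lambda>s. if ?E s then w {u, v} s else 0) \<in> borel_measurable \<Sigma>"
  proof (rule measurableI)
    fix B :: "real set" assume "B \<in> sets borel"
    have "(\<lambda>s. if ?E s then w {u, v} s else 0) -` B \<inter> space \<Sigma> =
      {s \<in> space M. ?E s \<and> w {u, v} s \<in> B} \<union>
      (if 0 \<in> B then space \<Sigma> - {s \<in> space \<Sigma>. ?E s} else {})"
      by (auto simp: space_weighted_tree_sigma split: if_splits)
    also have "\<dots> \<in> sets \<Sigma>"
      using pre[OF \<open>B \<in> sets borel\<close>] t by auto
    finally show "(\<lambda>s. if ?E s then w {u, v} s else 0) -` B \<inter> space \<Sigma> \<in> sets \<Sigma>" .
  qed simp
qed

text \<open>Induction along the termination measure of \<open>ball_messages\<close>, with every
  weight masked outside the tree.\<close>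

lemma measurable_ball_messages:
  "(\<lambda>s. ball_messages (sample_tree N s) (\<lambda>e. w e s) (\<lambda>a. x a s) b H u v) \<in> borel_measurable \<Sigma>"
    (is "?f u v \<in> _")
proof (induction "if length u < length v then H + 1 - length v else H + 2 + length v"
    arbitrary: u v rule: less_induct)
  case less
  consider "\<not> uh_adjacent u v \<or> length u > H + 1 \<or> length v > H + 1"
    | "length v = H + 1" "uh_adjacent u v" "length u \<le> H + 1"
    | "length v \<le> H" "uh_adjacent u v" "length u \<le> H + 1" by linarith
  then show ?case
  proof cases
    case 1
    then have "?f u v = (\<lambda>_. 0)"
      by (intro ext, subst ball_messages.simps, simp only: directed_edges_root_ball)
        (auto simp: directed_edges_def)
    then show ?thesis by simp
  next
    case 2
    then have "?f u v = (\<lambda>s. if (u, v) \<in> directed_edges (sample_tree N s) then b else 0)"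
      by (intro ext, subst ball_messages.simps)
        (auto simp: directed_edges_root_ball ball_boundary_def, auto simp: directed_edges_def)
    then show ?thesis
      using sets_edge by (auto intro!: measurable_If)
  next
    case 3
    let ?e = "\<lambda>u v s. (u, v) \<in> directed_edges (sample_tree N s)"
    let ?w = "\<lambda>u v s. if ?e u v s then w {u, v} s else 0"
    \<comment> \<open>The conjunct \<open>uh_adjacent v u'\<close> follows from being an edge but
      does not depend on the sample. It selects the indices to which the induction hypothesis
      applies; at the other ones the term is constantly \<open>- \<infinity>\<close>.\<close>
    have *: "?f u v = (\<lambda>s. if ?e u v s then
        max (if v \<in> sample_tree N s then ereal (x v s) else - \<infinity>)
          (SUP u'. if ?e v u' s \<and> u' \<noteq> u \<and> uh_adjacent v u'
              then ereal (?w v u' s) - ?f v u' s else - \<infinity>) else 0)"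
    proof
      fix s
      show "?f u v s = (if ?e u v s then
        max (if v \<in> sample_tree N s then ereal (x v s) else - \<infinity>)
          (SUP u'. if ?e v u' s \<and> u' \<noteq> u \<and> uh_adjacent v u'
              then ereal (?w v u' s) - ?f v u' s else - \<infinity>) else 0)"
      proof (cases "?e u v s")
        case False
        then show ?thesis
          by (subst ball_messages.simps) (auto simp: directed_edges_root_ball)
      next
        case True
        then have "v \<in> sample_tree N s"
          by (simp add: directed_edges_def)
        moreover have "(?e v u' s \<and> u' \<noteq> u \<and> uh_adjacent v u') = (?e v u' s \<and> u' \<noteq> u)" for u'
          by (auto simp: directed_edges_def)
        ultimately show ?thesis
          using True 3
          by (subst ball_messages_rec) (auto simp: message_rhs_def SUP_Collect_ereal intro!: arg_cong2[where f = max] SUP_cong)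
      qed
    qed
    have "(\<lambda>s. if ?e v u' s \<and> u' \<noteq> u \<and> uh_adjacent v u'
        then ereal (?w v u' s) - ?f v u' s else - \<infinity>) \<in> borel_measurable \<Sigma>" for u'
    proof (cases "u' \<noteq> u \<and> uh_adjacent v u'")
      case True
      have "?f v u' \<in> borel_measurable \<Sigma>"
        by (rule less.hyps) (use 3 True in \<open>auto simp: uh_adjacent_def\<close>)
      then have "(\<lambda>s. if ?e v u' s then ereal (?w v u' s) - ?f v u' s else - \<infinity>) \<in> borel_measurable \<Sigma>"
        using sets_edge
        by (intro measurable_If borel_measurable_ereal_diff borel_measurable_ereal measurable_edge_weight) auto
      then show ?thesis using True by simp
    next
      case False
      then have "\<not> (?e v u' s \<and> u' \<noteq> u \<and> uh_adjacent v u')" for s by blast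
      then show ?thesis by (simp only: if_False measurable_const space_borel UNIV_I)
    qed
    then have sup: "(\<lambda>s. SUP u'. if ?e v u' s \<and> u' \<noteq> u \<and> uh_adjacent v u'
        then ereal (?w v u' s) - ?f v u' s else - \<infinity>) \<in> borel_measurable \<Sigma>"
      by (rule borel_measurable_SUP[rotated]) simp
    show ?thesis
      unfolding *
      by (rule measurable_If, rule borel_measurable_max, rule sup, rule measurable_vertex_weight,
        simp, rule sets_edge)
  qed
qed

lemma measurable_ball_limit:
  "(\<lambda>s. ball_limit (sample_tree N s) (\<lambda>e. w e s) (\<lambda>a. x a s) u v) \<in> borel_measurable \<Sigma>"
  unfolding ball_limit_def
  by (intro borel_measurable_liminf measurable_ball_messages)

end


section \<open>The coupled recursion for the bounds\<close>

text \<open>The probability that the first of \<open>Suc k\<close> independent samples is the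
  largest and exceeds \<open>x\<close>: by exchangeability it is an equal share of the probability
  that some sample exceeds \<open>x\<close>. The induction writes one factor of the power as an
  integral and exchanges the order of integration.\<close>

lemma atomless_power_integral:
  fixes \<mu> :: "real measure"
  assumes "real_distribution \<mu>" and atomless: "\<And>a. measure \<mu> {a} = 0"
  shows "(\<integral>t. indicator {x<..} t * measure \<mu> {..<t} ^ k \<partial>\<mu>) =
    (1 - measure \<mu> {..<x} ^ Suc k) / real (Suc k)"
proof -
  interpret real_distribution \<mu> by fact
  define g where "g t = measure \<mu> {..<t}" for t
  have le_eq: "measure \<mu> {..x} = g x" for x
  proof -
    have "measure \<mu> ({..<x} \<union> {x}) = g x + measure \<mu> {x}"
      unfolding g_def by (intro finite_measure_Union) auto
    also have "{..<x} \<union> {x} = {..x}" by auto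
    finally show ?thesis by (simp add: atomless)
  qed
  have [measurable]: "g \<in> borel_measurable borel"
    unfolding g_def by (intro borel_measurable_mono monoI finite_measure_mono) auto
  have g_bounds: "0 \<le> g t" "g t \<le> 1" for t by (auto simp: g_def)
  have int: "integrable \<mu> (\<lambda>t. indicator {x<..} t * g t ^ k)" for k x
    by (rule integrable_const_bound[where B = 1])
      (auto simp: indicator_def g_bounds power_le_one)
  have "(\<integral>t. indicator {x<..} t * g t ^ k \<partial>\<mu>) = (1 - g x ^ Suc k) / real (Suc k)" for k x
  proof (induction k arbitrary: x)
    case 0
    have "measure \<mu> {x<..} = 1 - measure \<mu> {..x}"
      using prob_compl[of "{..x}"] by (simp add: Compl_eq_Diff_UNIV[symmetric] Compl_atMost)
    then show ?case by (simp add: le_eq)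
  next
    case (Suc k)
    define I where "I = (\<integral>t. indicator {x<..} t * g t ^ Suc k \<partial>\<mu>)"
    interpret pair_sigma_finite \<mu> \<mu> ..
    have g_int: "g t = (\<integral>s. indicator {s<..} t \<partial>\<mu>)" for t
    proof -
      have "(\<lambda>s. indicator {s<..} t :: real) = indicator {..<t}"
        by (auto simp: indicator_def fun_eq_iff)
      then show ?thesis by (simp add: g_def)
    qed
    have "I = (\<integral>t. (\<integral>s. indicator {x<..} t * g t ^ k * indicator {s<..} t \<partial>\<mu>) \<partial>\<mu>)"
      unfolding I_def by (simp add: g_int[symmetric] mult_ac)
    also have "\<dots> = (\<integral>s. (\<integral>t. indicator {x<..} t * g t ^ k * indicator {s<..} t \<partial>\<mu>) \<partial>\<mu>)"
    proof (rule Fubini_integral)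
      interpret \<mu>\<mu>: prob_space "\<mu> \<Otimes>\<^sub>M \<mu>"
        using prob_space_axioms by (intro prob_space_pair)
      show "integrable (\<mu> \<Otimes>\<^sub>M \<mu>) (\<lambda>(t, s). indicator {x<..} s * g s ^ k * indicator {t<..} s)"
        by (rule \<mu>\<mu>.integrable_const_bound[where B = 1])
          (auto simp: indicator_def g_bounds power_le_one split_beta')
    qed
    also have "\<dots> = (\<integral>s. (1 - g (max x s) ^ Suc k) / real (Suc k) \<partial>\<mu>)"
    proof (rule Bochner_Integration.integral_cong[OF refl])
      fix s
      have "(\<lambda>t. indicator {x<..} t * g t ^ k * indicator {s<..} t) =
          (\<lambda>t. indicator {max x s<..} t * g t ^ k)"
        by (auto simp: indicator_def fun_eq_iff)
      then show "(\<integral>t. indicator {x<..} t * g t ^ k * indicator {s<..} t \<partial>\<mu>) =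
          (1 - g (max x s) ^ Suc k) / real (Suc k)"
        by (simp only: Suc.IH)
    qed
    \<comment> \<open>Splitting at \<open>s = x\<close>: above \<open>x\<close> the integrand is
      that of \<open>I\<close> again, so a linear equation for \<open>I\<close> results.\<close>
    also have "\<dots> = (\<integral>s. (1 - indicator {..x} s * g x ^ Suc k - indicator {x<..} s * g s ^ Suc k) / real (Suc k) \<partial>\<mu>)"
      by (intro Bochner_Integration.integral_cong refl) (auto simp: indicator_def max_def)
    also have "\<dots> = (1 - g x ^ Suc k * g x - I) / real (Suc k)"
    proof -
      have i: "integrable \<mu> (\<lambda>s. indicator {..x} s * g x ^ Suc k)"
        by (rule integrable_const_bound[where B = 1])
          (auto simp: indicator_def g_bounds power_le_one simp del: power_Suc)
      have "(\<integral>s. 1 - indicator {..x} s * g x ^ Suc k - indicator {x<..} s * g s ^ Suc k \<partial>\<mu>) =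
          (\<integral>s. 1 \<partial>\<mu>) - (\<integral>s. indicator {..x} s * g x ^ Suc k \<partial>\<mu>) - I"
        unfolding I_def using i int[of x "Suc k"]
        by (simp only: Bochner_Integration.integral_diff Bochner_Integration.integrable_diff integrable_const)
      also have "\<dots> = 1 - g x ^ Suc k * g x - I"
        by (simp add: le_eq prob_space[simplified] del: power_Suc)
      finally show ?thesis by (simp del: power_Suc)
    qed
    finally have "I * real (Suc k) = 1 - g x ^ Suc (Suc k) - I"
      by (simp add: field_simps)
    then have "I * real (Suc (Suc k)) = 1 - g x ^ Suc (Suc k)"
      by (simp add: algebra_simps)
    then show ?case
      unfolding I_def[symmetric] by (simp add: eq_divide_eq del: power_Suc)
  qed
  then show ?thesis by (simp add: g_def)
qed

text \<open>The supremum of all almost sure lower bounds of \<open>f\<close> on \<open>R\<close>. It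
  is finite because \<open>R\<close> is not null, and countably many bounds approaching it show that
  it is itself a lower bound.\<close>

lemma (in finite_measure) ess_inf_on_exists:
  fixes f :: "'a \<Rightarrow> real"
  assumes f[measurable]: "f \<in> borel_measurable M" and R[measurable]: "Measurable.pred M R"
    and pos: "\<not> (AE z in M. \<not> R z)" and lb: "AE z in M. R z \<longrightarrow> b \<le> f z"
  obtains r where "AE z in M. R z \<longrightarrow> r \<le> f z"
    and "\<And>e. e > 0 \<Longrightarrow> measure M {z \<in> space M. R z \<and> f z < r + e} > 0"
proof -
  define A where "A = {t. AE z in M. R z \<longrightarrow> t \<le> f z}"
  have "b \<in> A" using lb by (simp add: A_def)
  have bdd: "bdd_above A"
  proof (rule ccontr)
    assume "\<not> bdd_above A"
    then have "\<exists>t\<in>A. real n < t" for n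
      by (auto simp: bdd_above_def not_le)
    then have "AE z in M. R z \<longrightarrow> real n \<le> f z" for n
    proof -
      obtain t where "AE z in M. R z \<longrightarrow> t \<le> f z" "real n < t"
        using \<open>\<And>n. \<exists>t\<in>A. real n < t\<close>[of n] by (auto simp: A_def)
      then show ?thesis by (auto elim!: eventually_mono)
    qed
    then have "AE z in M. \<forall>n. R z \<longrightarrow> real n \<le> f z"
      unfolding AE_all_countable by blast
    then have "AE z in M. \<not> R z"
      by eventually_elim (meson not_le reals_Archimedean2)
    with pos show False ..
  qed
  have A_less: "t \<in> A" if less: "t < Sup A" for t
  proof -
    obtain t' where "t' \<in> A" "t < t'"
      using less_cSupD[OF _ less] \<open>b \<in> A\<close> by blast
    then show ?thesis by (auto simp: A_def elim!: eventually_mono)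
  qed
  have "AE z in M. R z \<longrightarrow> Sup A - inverse (real (Suc n)) \<le> f z" for n
    using A_less[of "Sup A - inverse (real (Suc n))"] by (simp add: A_def)
  then have "AE z in M. \<forall>n. R z \<longrightarrow> Sup A - inverse (real (Suc n)) \<le> f z"
    unfolding AE_all_countable by blast
  then have "AE z in M. R z \<longrightarrow> Sup A \<le> f z"
  proof eventually_elim
    case (elim z)
    show ?case
    proof
      assume "R z"
      show "Sup A \<le> f z"
      proof (rule ccontr)
        assume "\<not> Sup A \<le> f z"
        then obtain n where "inverse (real (Suc n)) < Sup A - f z"
          using reals_Archimedean[of "Sup A - f z"] by auto
        with elim \<open>R z\<close> show False by (smt (verit))
      qed
    qed
  qed
  moreover have "measure M {z \<in> space M. R z \<and> f z < Sup A + e} > 0" if "e > 0" for e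
  proof (rule ccontr)
    assume "\<not> measure M {z \<in> space M. R z \<and> f z < Sup A + e} > 0"
    then have "measure M {z \<in> space M. R z \<and> f z < Sup A + e} = 0"
      by (simp add: zero_less_measure_iff)
    then have "AE z in M. \<not> (R z \<and> f z < Sup A + e)"
      by (intro AE_I'[of "{z \<in> space M. R z \<and> f z < Sup A + e}"])
        (auto simp: null_sets_def emeasure_eq_measure)
    then have "Sup A + e \<in> A"
      by (auto simp: A_def elim!: eventually_mono)
    then show False using cSup_upper[OF _ bdd] that by fastforce
  qed
  ultimately show ?thesis by (rule that)
qed

lemma (in finite_measure) AE_iff_measure_0:
  assumes "Measurable.pred M Q"
  shows "(AE z in M. \<not> Q z) \<longleftrightarrow> measure M {z \<in> space M. Q z} = 0"
  using assms by (subst AE_iff_measurable[OF _ refl]) (auto simp: emeasure_eq_measure)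

lemma Collect_in_sets:
  assumes "Measurable.pred N Q" "space N = UNIV"
  shows "{z. Q z} \<in> sets N"
  using assms by (simp add: pred_def)

text \<open>\<open>Y = (l, u)\<close> solves the recursion with independent children \<open>C i\<close> distributed like \<open>Y\<close>.\<close>

locale coupled_recursion = prob_space P for P :: "'a measure" +
  fixes q :: "nat pmf" and \<omega> \<xi> :: "real measure" and m a :: real and top_w :: ereal
    and \<Lambda> :: "(real \<times> real) measure"
    and K :: "'a \<Rightarrow> nat" and X :: "'a \<Rightarrow> real" and W :: "nat \<Rightarrow> 'a \<Rightarrow> real"
    and C :: "nat \<Rightarrow> 'a \<Rightarrow> real \<times> real" and Y :: "'a \<Rightarrow> real \<times> real"
  assumes omega: "real_distribution \<omega>" and xi: "real_distribution \<xi>"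
    and K_measurable[measurable]: "K \<in> measurable P (count_space UNIV)"
    and X_measurable[measurable]: "X \<in> borel_measurable P"
    and W_measurable[measurable]: "\<And>i. W i \<in> borel_measurable P"
    and C_measurable[measurable]: "\<And>i. C i \<in> measurable P (borel \<Otimes>\<^sub>M borel)"
    and Y_measurable[measurable]: "Y \<in> measurable P (borel \<Otimes>\<^sub>M borel)"
    and law: "\<Lambda> = distr P (borel \<Otimes>\<^sub>M borel) Y"
    and joint: "\<And>k A B. A \<in> sets borel \<Longrightarrow> B \<in> sets (borel \<Otimes>\<^sub>M (borel \<Otimes>\<^sub>M borel)) \<Longrightarrow>
      prob {\<zeta> \<in> space P. K \<zeta> = k \<and> X \<zeta> \<in> A \<and> (\<forall>i<k. (W i \<zeta>, C i \<zeta>) \<in> B)} =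
        pmf q k * measure \<xi> A * measure (\<omega> \<Otimes>\<^sub>M \<Lambda>) B ^ k"
    and lower_eq: "AE \<zeta> in P. fst (Y \<zeta>) =
      Max (insert (X \<zeta>) ((\<lambda>i. W i \<zeta> - snd (C i \<zeta>)) ` {..<K \<zeta>}))"
    and upper_eq: "AE \<zeta> in P. snd (Y \<zeta>) =
      Max (insert (X \<zeta>) ((\<lambda>i. W i \<zeta> - fst (C i \<zeta>)) ` {..<K \<zeta>}))"
    and bounds: "AE z in \<Lambda>. m \<le> fst z \<and> fst z \<le> snd z"
    and xi_ge: "AE t in \<xi>. m \<le> t"
    and xi_near: "\<And>e. e > 0 \<Longrightarrow> measure \<xi> {..<m + e} > 0"
    and omega_atomless: "\<And>t. measure \<omega> {t} = 0"
    and omega_le: "AE t in \<omega>. ereal t \<le> top_w"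
    and a_less: "ereal a < top_w"
    and omega_pos: "\<And>c d. a \<le> c \<Longrightarrow> c < d \<Longrightarrow> ereal d \<le> top_w \<Longrightarrow> measure \<omega> {c<..<d} > 0"
begin

interpretation \<omega>: real_distribution \<omega> by (rule omega)
interpretation \<xi>: real_distribution \<xi> by (rule xi)
interpretation \<Lambda>: prob_space \<Lambda>
  unfolding law by (rule prob_space_distr) measurable

lemma sets_Lambda[measurable_cong, simp]: "sets \<Lambda> = sets (borel \<Otimes>\<^sub>M borel)"
  by (simp add: law)

lemma space_Lambda[simp]: "space \<Lambda> = UNIV"
  by (simp add: law space_pair_measure)

abbreviation "\<rho> \<equiv> \<omega> \<Otimes>\<^sub>M \<Lambda>"

interpretation \<rho>: prob_space \<rho>
  by (intro prob_space_pair \<omega>.prob_space_axioms \<Lambda>.prob_space_axioms)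

interpretation \<omega>\<Lambda>: pair_sigma_finite \<omega> \<Lambda> ..
interpretation \<Lambda>\<Lambda>: pair_sigma_finite \<Lambda> \<Lambda> ..

lemma space_rho[simp]: "space \<rho> = UNIV"
  by (simp add: space_pair_measure)

lemma sets_rho: "sets \<rho> = sets (borel \<Otimes>\<^sub>M (borel \<Otimes>\<^sub>M borel))"
  by (intro sets_pair_measure_cong) auto

lemma AE_law_iff:
  assumes "Measurable.pred (borel \<Otimes>\<^sub>M borel) Q"
  shows "(AE z in \<Lambda>. Q z) \<longleftrightarrow> (AE \<zeta> in P. Q (Y \<zeta>))"
  unfolding law using assms by (subst AE_distr_iff) (auto simp: pred_def)

lemma emeasure_root_children:
  assumes [measurable]: "A \<in> sets borel" "B \<in> sets (borel \<Otimes>\<^sub>M (borel \<Otimes>\<^sub>M borel))"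
  shows "emeasure P {\<zeta> \<in> space P. X \<zeta> \<in> A \<and> (\<forall>i<K \<zeta>. (W i \<zeta>, C i \<zeta>) \<in> B)} =
    (\<Sum>k. ennreal (pmf q k * measure \<xi> A * measure \<rho> B ^ k))"
proof -
  let ?E = "\<lambda>k. {\<zeta> \<in> space P. K \<zeta> = k \<and> X \<zeta> \<in> A \<and> (\<forall>i<k. (W i \<zeta>, C i \<zeta>) \<in> B)}"
  have "{\<zeta> \<in> space P. X \<zeta> \<in> A \<and> (\<forall>i<K \<zeta>. (W i \<zeta>, C i \<zeta>) \<in> B)} = (\<Union>k. ?E k)"
    by auto
  also have "emeasure P \<dots> = (\<Sum>k. emeasure P (?E k))"
  proof (rule suminf_emeasure[symmetric])
    have "?E k \<in> sets P" for k by measurable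
    then show "range ?E \<subseteq> sets P" by blast
    show "disjoint_family ?E" by (auto simp: disjoint_family_on_def)
  qed
  also have "\<dots> = (\<Sum>k. ennreal (pmf q k * measure \<xi> A * measure \<rho> B ^ k))"
    by (simp add: emeasure_eq_measure joint assms)
  finally show ?thesis .
qed

text \<open>By \<open>joint\<close>, an almost sure property of one child contributes a factor 1 for
  each of the \<open>k\<close> children, and what remains is the total mass of
  \<open>q\<close>.\<close>

lemma AE_children:
  assumes Q: "AE p in \<rho>. Q p" and [measurable]: "Measurable.pred (borel \<Otimes>\<^sub>M (borel \<Otimes>\<^sub>M borel)) Q"
  shows "AE \<zeta> in P. \<forall>i<K \<zeta>. Q (W i \<zeta>, C i \<zeta>)"
proof -
  let ?B = "{p. Q p}"
  have B[measurable]: "?B \<in> sets (borel \<Otimes>\<^sub>M (borel \<Otimes>\<^sub>M borel))"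
    using assms(2) by (simp add: pred_def space_pair_measure)
  have "measure \<rho> ?B = 1"
    using Q \<rho>.prob_Collect_eq_1[of Q] B sets_rho by simp
  then have "emeasure P {\<zeta> \<in> space P. X \<zeta> \<in> UNIV \<and> (\<forall>i<K \<zeta>. (W i \<zeta>, C i \<zeta>) \<in> ?B)} =
      (\<Sum>k. ennreal (pmf q k))"
    by (subst emeasure_root_children) (auto simp: B \<xi>.prob_space[simplified])
  also have "\<dots> = 1"
    by (simp add: nn_integral_count_space_nat[symmetric] nn_integral_pmf measure_pmf.emeasure_space_1[simplified])
  finally have "prob {\<zeta> \<in> space P. \<forall>i<K \<zeta>. Q (W i \<zeta>, C i \<zeta>)} = 1"
    by (simp add: measure_def)
  then show ?thesis
    by (subst (asm) prob_Collect_eq_1) auto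
qed

section \<open>An edge between two independent subtrees\<close>

definition "less_prob h t = measure \<rho> {p. fst p - h (snd p) < t}"

text \<open>The maximum is below \<open>t\<close> exactly when the vertex weight and the terms of
  all children are, which produces the generating function of \<open>q\<close> at
  \<open>less_prob h t\<close>. Taking \<open>fst\<close> and \<open>snd\<close> for
  \<open>h\<close> and \<open>h'\<close>, in either order, covers both equations of the
  recursion.\<close>

lemma emeasure_Lambda_less:
  assumes h[measurable]: "h \<in> borel_measurable (borel \<Otimes>\<^sub>M borel)"
    and h'[measurable]: "h' \<in> borel_measurable (borel \<Otimes>\<^sub>M borel)"
    and eq: "AE \<zeta> in P. h' (Y \<zeta>) = Max (insert (X \<zeta>) ((\<lambda>i. W i \<zeta> - h (C i \<zeta>)) ` {..<K \<zeta>}))"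
  shows "emeasure \<Lambda> {z. h' z < t} =
    (\<Sum>k. ennreal (pmf q k * measure \<xi> {..<t} * less_prob h t ^ k))"
proof -
  have B: "{p. fst p - h (snd p) < t} \<in> sets (borel \<Otimes>\<^sub>M (borel \<Otimes>\<^sub>M borel))"
    by (rule Collect_in_sets) (measurable, simp add: space_pair_measure)
  have "{z. h' z < t} \<in> sets (borel \<Otimes>\<^sub>M borel)"
    by (rule Collect_in_sets) (measurable, simp add: space_pair_measure)
  then have "emeasure \<Lambda> {z. h' z < t} = emeasure P {\<zeta> \<in> space P. h' (Y \<zeta>) < t}"
    unfolding law by (subst emeasure_distr) (auto intro!: arg_cong[where f = "emeasure P"] simp: space_pair_measure)
  also have "\<dots> = emeasure P {\<zeta> \<in> space P. X \<zeta> \<in> {..<t} \<and>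
      (\<forall>i<K \<zeta>. (W i \<zeta>, C i \<zeta>) \<in> {p. fst p - h (snd p) < t})}"
    using eq B by (intro emeasure_eq_AE) (auto elim!: eventually_mono)
  also have "\<dots> = (\<Sum>k. ennreal (pmf q k * measure \<xi> {..<t} * less_prob h t ^ k))"
    using B by (subst emeasure_root_children) (auto simp: less_prob_def)
  finally show ?thesis .
qed

lemma measurable_less_prob[measurable]:
  assumes [measurable]: "h \<in> borel_measurable (borel \<Otimes>\<^sub>M borel)"
  shows "less_prob h \<in> borel_measurable borel"
proof -
  have "{p. fst p - h (snd p) < t} \<in> sets \<rho>" for t
    unfolding sets_rho by (rule Collect_in_sets) (measurable, simp add: space_pair_measure)
  then show ?thesis
    unfolding less_prob_def
    by (intro borel_measurable_mono monoI \<rho>.finite_measure_mono) auto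
qed

lemma less_prob_bounds: "0 \<le> less_prob h t" "less_prob h t \<le> 1"
  by (auto simp: less_prob_def)

text \<open>Closed form of the expectation of \<open>less_prob h T ^ k\<close> on the event that
  \<open>T\<close> exceeds an independent vertex weight, where \<open>T\<close> is distributed like
  \<open>w - h\<close>.\<close>

definition "excess h k = (\<integral>t. (1 - less_prob h t ^ Suc k) / real (Suc k) \<partial>\<xi>)"

lemma integrable_excess:
  assumes [measurable]: "h \<in> borel_measurable (borel \<Otimes>\<^sub>M borel)"
  shows "integrable \<xi> (\<lambda>t. (1 - less_prob h t ^ Suc k) / real (Suc k))"
    and "integrable \<xi> (\<lambda>t. less_prob h t ^ k)"
proof -
  show *: "integrable \<xi> (\<lambda>t. less_prob h t ^ k)" for k
    by (rule \<xi>.integrable_const_bound[where B = 1]) (auto simp: less_prob_bounds power_le_one)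
  show "integrable \<xi> (\<lambda>t. (1 - less_prob h t ^ Suc k) / real (Suc k))"
    using *[of "Suc k"] by (intro integrable_divide Bochner_Integration.integrable_diff) auto
qed

text \<open>The left side is the probability of \<open>w > h z + h' z'\<close> for independent
  \<open>z\<close> and \<open>z'\<close>. Expressing the law of \<open>h'\<close> through that of
  \<open>w - h\<close> leaves powers of a distribution function integrated against its own law, so
  the right side depends on \<open>h\<close> alone.\<close>

lemma nn_integral_less:
  assumes h[measurable]: "h \<in> borel_measurable (borel \<Otimes>\<^sub>M borel)"
    and h'[measurable]: "h' \<in> borel_measurable (borel \<Otimes>\<^sub>M borel)"
    and eq: "AE \<zeta> in P. h' (Y \<zeta>) = Max (insert (X \<zeta>) ((\<lambda>i. W i \<zeta> - h (C i \<zeta>)) ` {..<K \<zeta>}))"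
  shows "(\<integral>\<^sup>+p. emeasure \<Lambda> {z. h' z < fst p - h (snd p)} \<partial>\<rho>) =
    (\<Sum>k. ennreal (pmf q k * excess h k))"
proof -
  define \<mu> where "\<mu> = distr \<rho> borel (\<lambda>p. fst p - h (snd p))"
  have \<mu>: "real_distribution \<mu>"
    unfolding \<mu>_def real_distribution_def real_distribution_axioms_def
    by (auto intro!: \<rho>.prob_space_distr)
  interpret \<mu>: real_distribution \<mu> by (rule \<mu>)
  interpret \<mu>\<xi>: pair_sigma_finite \<mu> \<xi> ..
  have meas: "measure \<mu> {..<t} = less_prob h t" for t
    unfolding \<mu>_def less_prob_def by (subst measure_distr) (auto intro!: arg_cong[where f = "measure \<rho>"])
  \<comment> \<open>The weight \<open>w\<close> is atomless and independent of \<open>h z\<close>: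
    for each fixed \<open>z\<close> it misses \<open>t + h z\<close> almost surely, and Fubini does
    the rest.\<close>
  have atom: "measure \<mu> {t} = 0" for t
  proof -
    have "AE w in \<omega>. w - h z \<noteq> t" for z
    proof -
      have "AE w in \<omega>. w \<noteq> t + h z"
        using \<omega>.AE_iff_measure_0[of "\<lambda>w. w = t + h z"] omega_atomless by simp
      then show ?thesis by eventually_elim auto
    qed
    moreover have D: "{p. fst p - h (snd p) \<noteq> t} \<in> sets (borel \<Otimes>\<^sub>M (borel \<Otimes>\<^sub>M borel))"
      by (rule Collect_in_sets) (measurable, simp add: space_pair_measure)
    ultimately have "AE z in \<Lambda>. AE w in \<omega>. fst (w, z) - h (snd (w, z)) \<noteq> t"
      by simp
    then have "AE w in \<omega>. AE z in \<Lambda>. fst (w, z) - h (snd (w, z)) \<noteq> t"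
      using D by (subst \<omega>\<Lambda>.AE_commute) (auto simp: sets_rho)
    then have "AE p in \<rho>. \<not> (fst p - h (snd p) = t)"
      by (intro \<omega>\<Lambda>.AE_pair_measure) (auto simp: split_beta' sets_rho D)
    then have "measure \<rho> {p \<in> space \<rho>. fst p - h (snd p) = t} = 0"
      by (subst (asm) \<rho>.AE_iff_measure_0) auto
    then show ?thesis
      unfolding \<mu>_def by (subst measure_distr) (auto simp: vimage_def)
  qed
  have inner: "(\<integral>\<^sup>+t. ennreal (measure \<xi> {..<t} * less_prob h t ^ k) \<partial>\<mu>) = ennreal (excess h k)" for k
  proof -
    have "ennreal (measure \<xi> {..<t} * less_prob h t ^ k) =
        (\<integral>\<^sup>+y. ennreal (indicator {y<..} t * less_prob h t ^ k) \<partial>\<xi>)" for t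
    proof -
      have "(\<integral>\<^sup>+y. ennreal (indicator {y<..} t * less_prob h t ^ k) \<partial>\<xi>) =
          (\<integral>\<^sup>+y. indicator {..<t} y * ennreal (less_prob h t ^ k) \<partial>\<xi>)"
        by (intro nn_integral_cong) (auto simp: indicator_def)
      also have "\<dots> = emeasure \<xi> {..<t} * ennreal (less_prob h t ^ k)"
        by (simp add: nn_integral_multc)
      finally show ?thesis
        by (simp add: \<xi>.emeasure_eq_measure ennreal_mult less_prob_bounds)
    qed
    then have "(\<integral>\<^sup>+t. ennreal (measure \<xi> {..<t} * less_prob h t ^ k) \<partial>\<mu>) =
        (\<integral>\<^sup>+t. \<integral>\<^sup>+y. ennreal (indicator {y<..} t * less_prob h t ^ k) \<partial>\<xi> \<partial>\<mu>)"
      by simp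
    also have "\<dots> = (\<integral>\<^sup>+y. \<integral>\<^sup>+t. ennreal (indicator {y<..} t * less_prob h t ^ k) \<partial>\<mu> \<partial>\<xi>)"
      by (rule \<mu>\<xi>.Fubini'[symmetric]) (auto simp: indicator_def split_beta')
    also have "\<dots> = (\<integral>\<^sup>+y. ennreal ((1 - less_prob h y ^ Suc k) / real (Suc k)) \<partial>\<xi>)"
    proof (rule nn_integral_cong)
      fix y
      have "integrable \<mu> (\<lambda>t. indicator {y<..} t * less_prob h t ^ k)"
        by (rule \<mu>.integrable_const_bound[where B = 1])
          (auto simp: indicator_def less_prob_bounds power_le_one)
      then have "(\<integral>\<^sup>+t. ennreal (indicator {y<..} t * less_prob h t ^ k) \<partial>\<mu>) =
          ennreal (\<integral>t. indicator {y<..} t * less_prob h t ^ k \<partial>\<mu>)"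
        by (intro nn_integral_eq_integral) (auto simp: less_prob_bounds)
      also have "(\<integral>t. indicator {y<..} t * less_prob h t ^ k \<partial>\<mu>) = (1 - less_prob h y ^ Suc k) / real (Suc k)"
        using atomless_power_integral[OF \<mu> atom, of y k] by (simp only: meas)
      finally show "(\<integral>\<^sup>+t. ennreal (indicator {y<..} t * less_prob h t ^ k) \<partial>\<mu>) =
          ennreal ((1 - less_prob h y ^ Suc k) / real (Suc k))" .
    qed
    also have "\<dots> = ennreal (excess h k)"
      unfolding excess_def
      using integrable_excess(1)[of h k] h
      by (intro nn_integral_eq_integral) (auto simp: less_prob_bounds power_le_one simp del: power_Suc intro!: divide_nonneg_nonneg)
    finally show ?thesis .
  qed
  have [measurable]: "(\<lambda>t. measure \<xi> {..<t}) \<in> borel_measurable borel"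
    by (intro borel_measurable_mono monoI \<xi>.finite_measure_mono) auto
  have "(\<integral>\<^sup>+p. emeasure \<Lambda> {z. h' z < fst p - h (snd p)} \<partial>\<rho>) =
      (\<integral>\<^sup>+p. (\<Sum>k. ennreal (pmf q k * measure \<xi> {..<fst p - h (snd p)} * less_prob h (fst p - h (snd p)) ^ k)) \<partial>\<rho>)"
    by (simp only: emeasure_Lambda_less[OF h h' eq])
  also have "\<dots> = (\<integral>\<^sup>+t. (\<Sum>k. ennreal (pmf q k * measure \<xi> {..<t} * less_prob h t ^ k)) \<partial>\<mu>)"
    unfolding \<mu>_def by (subst nn_integral_distr) simp_all
  also have "\<dots> = (\<Sum>k. (\<integral>\<^sup>+t. ennreal (pmf q k * measure \<xi> {..<t} * less_prob h t ^ k) \<partial>\<mu>))"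
    by (subst nn_integral_suminf) simp_all
  also have "\<dots> = (\<Sum>k. ennreal (pmf q k) * (\<integral>\<^sup>+t. ennreal (measure \<xi> {..<t} * less_prob h t ^ k) \<partial>\<mu>))"
    by (intro suminf_cong, subst nn_integral_cmult[symmetric])

      (auto intro!: nn_integral_cong simp: ennreal_mult[symmetric] less_prob_bounds mult.assoc)
  also have "\<dots> = (\<Sum>k. ennreal (pmf q k * excess h k))"
    by (simp only: inner) (simp add: ennreal_mult')
  finally show ?thesis .
qed

text \<open>Both sides are the probability that \<open>w\<close> exceeds \<open>h z + h' z'\<close>
  for independent \<open>z\<close> and \<open>z'\<close> of law \<open>\<Lambda>\<close>; exchanging
  the two copies exchanges \<open>h\<close> and \<open>h'\<close>.\<close>

lemma integral_swap:
  assumes [measurable]: "h \<in> borel_measurable (borel \<Otimes>\<^sub>M borel)" "h' \<in> borel_measurable (borel \<Otimes>\<^sub>M borel)"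
  shows "(\<integral>\<^sup>+p. emeasure \<Lambda> {z. h' z < fst p - h (snd p)} \<partial>\<rho>) =
    (\<integral>\<^sup>+p. emeasure \<Lambda> {z. h z < fst p - h' (snd p)} \<partial>\<rho>)"
proof -
  have *: "(\<integral>\<^sup>+p. emeasure \<Lambda> {z. f' z < fst p - f (snd p)} \<partial>\<rho>) =
      (\<integral>\<^sup>+w. \<integral>\<^sup>+z. \<integral>\<^sup>+z'. indicator {..<w} (f' z' + f z) \<partial>\<Lambda> \<partial>\<Lambda> \<partial>\<omega>)"
    if [measurable]: "f \<in> borel_measurable (borel \<Otimes>\<^sub>M borel)" "f' \<in> borel_measurable (borel \<Otimes>\<^sub>M borel)" for f f'
  proof -
    have "emeasure \<Lambda> {z. f' z < t} = (\<integral>\<^sup>+z. indicator {..<t} (f' z) \<partial>\<Lambda>)" for t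
    proof -
      have "{z. f' z < t} \<in> sets (borel \<Otimes>\<^sub>M borel)"
        by (rule Collect_in_sets) (measurable, simp add: space_pair_measure)
      then have "emeasure \<Lambda> {z. f' z < t} = (\<integral>\<^sup>+z. indicator {z. f' z < t} z \<partial>\<Lambda>)"
        by (subst nn_integral_indicator) auto
      also have "\<dots> = (\<integral>\<^sup>+z. indicator {..<t} (f' z) \<partial>\<Lambda>)"
        by (intro nn_integral_cong) (auto simp: indicator_def)
      finally show ?thesis .
    qed
    then have "(\<integral>\<^sup>+p. emeasure \<Lambda> {z. f' z < fst p - f (snd p)} \<partial>\<rho>) =
        (\<integral>\<^sup>+p. \<integral>\<^sup>+z'. indicator {..<fst p - f (snd p)} (f' z') \<partial>\<Lambda> \<partial>\<rho>)"
      by simp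
    also have "\<dots> = (\<integral>\<^sup>+w. \<integral>\<^sup>+z. \<integral>\<^sup>+z'. indicator {..<fst (w, z) - f (snd (w, z))} (f' z') \<partial>\<Lambda> \<partial>\<Lambda> \<partial>\<omega>)"
      by (subst \<Lambda>.nn_integral_fst[symmetric])
        (auto intro!: \<Lambda>.borel_measurable_nn_integral simp: indicator_def split_beta')
    also have "\<dots> = (\<integral>\<^sup>+w. \<integral>\<^sup>+z. \<integral>\<^sup>+z'. indicator {..<w} (f' z' + f z) \<partial>\<Lambda> \<partial>\<Lambda> \<partial>\<omega>)"
      by (intro nn_integral_cong) (auto simp: indicator_def)
    finally show ?thesis .
  qed
  have "(\<integral>\<^sup>+z. \<integral>\<^sup>+z'. indicator {..<w} (h' z' + h z) \<partial>\<Lambda> \<partial>\<Lambda>) =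
      (\<integral>\<^sup>+z. \<integral>\<^sup>+z'. indicator {..<w} (h z' + h' z) \<partial>\<Lambda> \<partial>\<Lambda>)" for w :: real
    by (subst \<Lambda>\<Lambda>.Fubini') (auto simp: indicator_def split_beta' add.commute)
  then show ?thesis
    by (simp add: *)
qed

lemma fst_borel: "fst \<in> borel_measurable (borel \<Otimes>\<^sub>M borel)" and snd_borel: "snd \<in> borel_measurable (borel \<Otimes>\<^sub>M borel)"
  by measurable

lemma excess_sum_eq: "(\<Sum>k. ennreal (pmf q k * excess fst k)) = (\<Sum>k. ennreal (pmf q k * excess snd k))"
  using nn_integral_less[OF fst_borel snd_borel upper_eq] nn_integral_less[OF snd_borel fst_borel lower_eq]
    integral_swap[OF fst_borel snd_borel] by simp

lemma AE_rho_bounds: "AE p in \<rho>. m \<le> fst (snd p) \<and> fst (snd p) \<le> snd (snd p)"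
proof (rule \<omega>\<Lambda>.AE_pair_measure)
  have "{p. m \<le> fst (snd p) \<and> fst (snd p) \<le> snd (snd p)} \<in> sets (borel \<Otimes>\<^sub>M (borel \<Otimes>\<^sub>M borel))"
    by (rule Collect_in_sets) (measurable, simp add: space_pair_measure)
  then show "{p \<in> space \<rho>. m \<le> fst (snd p) \<and> fst (snd p) \<le> snd (snd p)} \<in> sets \<rho>"
    by (simp add: sets_rho)
  show "AE w in \<omega>. AE z in \<Lambda>. m \<le> fst (snd (w, z)) \<and> fst (snd (w, z)) \<le> snd (snd (w, z))"
    using bounds by simp
qed

lemma less_set_rho: "{p. fst p - fst (snd p) < t} \<in> sets \<rho>" "{p. fst p - snd (snd p) < t} \<in> sets \<rho>"
  unfolding sets_rho by (rule Collect_in_sets; measurable?; simp add: space_pair_measure)+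

lemma less_prob_mono: "less_prob fst t \<le> less_prob snd t"
  unfolding less_prob_def
proof (rule \<rho>.finite_measure_mono_AE[OF _ less_set_rho(2)])
  show "AE p in \<rho>. p \<in> {p. fst p - fst (snd p) < t} \<longrightarrow> p \<in> {p. fst p - snd (snd p) < t}"
    using AE_rho_bounds by eventually_elim auto
qed

text \<open>Both sides of \<open>excess_sum_eq\<close> are finite and comparable term by term, so the terms agree.\<close>

lemma AE_less_prob_eq: "AE t in \<xi>. less_prob fst t = less_prob snd t"
proof -
  \<comment> \<open>One offspring number of positive probability suffices, because the power
    \<open>Suc k\<close> is injective on nonnegative reals, even for \<open>k = 0\<close>.\<close>
  obtain k where k: "pmf q k > 0"
    using set_pmf_not_empty[of q] by (auto simp: set_pmf_iff pmf_nonneg less_le)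
  have le: "excess snd k \<le> excess fst k" for k
    unfolding excess_def
    by (intro integral_mono integrable_excess fst_borel snd_borel divide_right_mono diff_left_mono
        power_mono less_prob_mono less_prob_bounds) auto
  have nonneg: "0 \<le> excess h k" for h k
    unfolding excess_def
    by (intro integral_nonneg_AE AE_I2 divide_nonneg_nonneg) (auto simp: less_prob_bounds power_le_one simp del: power_Suc)
  have le1: "excess h k \<le> 1" if "h \<in> borel_measurable (borel \<Otimes>\<^sub>M borel)" for h k
  proof -
    have "excess h k \<le> (\<integral>t. 1 \<partial>\<xi>)"
      unfolding excess_def
    proof (intro integral_mono integrable_excess that)
      fix t
      have "1 - less_prob h t ^ Suc k \<le> 1"
        using less_prob_bounds[of h t] by (simp del: power_Suc)
      also have "1 \<le> real (Suc k)" by simp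
      finally show "(1 - less_prob h t ^ Suc k) / real (Suc k) \<le> 1"
        by (simp add: divide_le_eq del: power_Suc)
    qed simp
    then show ?thesis by (simp add: \<xi>.prob_space[simplified])
  qed
  have summable_pmf: "summable (pmf q)"
    using integrable_pmf[of UNIV q] by (simp add: integrable_count_space_nat_iff)
  have summ: "summable (\<lambda>k. pmf q k * excess h k)" if "h \<in> borel_measurable (borel \<Otimes>\<^sub>M borel)" for h
    by (rule summable_comparison_test'[OF summable_pmf, of 0])
      (use nonneg le1[OF that] in \<open>auto simp: pmf_nonneg mult_left_le\<close>)
  have "(\<Sum>k. pmf q k * excess fst k) = (\<Sum>k. pmf q k * excess snd k)"
  proof -
    have "ennreal (\<Sum>k. pmf q k * excess fst k) = ennreal (\<Sum>k. pmf q k * excess snd k)"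
      using excess_sum_eq summ[OF fst_borel] summ[OF snd_borel] nonneg
      by (simp add: suminf_ennreal2 pmf_nonneg)
    then show ?thesis
      using summ[OF fst_borel] summ[OF snd_borel] nonneg
      by (subst (asm) ennreal_inj) (auto intro!: suminf_nonneg simp: pmf_nonneg)
  qed
  then have "(\<Sum>k. pmf q k * excess fst k - pmf q k * excess snd k) = 0"
    using summ[OF fst_borel] summ[OF snd_borel] by (simp add: suminf_diff[symmetric])
  then have "\<forall>k. pmf q k * excess fst k - pmf q k * excess snd k = 0"
    using le by (subst (asm) suminf_eq_zero_iff)
      (auto intro!: summable_diff summ fst_borel snd_borel mult_left_mono simp: pmf_nonneg)
  with k have "excess fst k - excess snd k = 0" by (metis eq_iff_diff_eq_0 less_irrefl mult_left_cancel)
  then have "(\<integral>t. (1 - less_prob fst t ^ Suc k) / real (Suc k) - (1 - less_prob snd t ^ Suc k) / real (Suc k) \<partial>\<xi>) = 0"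
    unfolding excess_def
    by (subst Bochner_Integration.integral_diff) (intro integrable_excess fst_borel snd_borel)+
  moreover have "0 \<le> (1 - less_prob fst t ^ Suc k) / real (Suc k) - (1 - less_prob snd t ^ Suc k) / real (Suc k)" for t
    using power_mono[OF less_prob_mono[of t] less_prob_bounds(1), of "Suc k"]
    by (simp add: divide_right_mono del: power_Suc)
  ultimately have "AE t in \<xi>. (1 - less_prob fst t ^ Suc k) / real (Suc k) - (1 - less_prob snd t ^ Suc k) / real (Suc k) = 0"
    by (subst (asm) integral_nonneg_eq_0_iff_AE)
      (auto intro!: Bochner_Integration.integrable_diff integrable_excess fst_borel snd_borel simp del: power_Suc)
  then show ?thesis
  proof eventually_elim
    case (elim t)
    then have "less_prob fst t ^ Suc k = less_prob snd t ^ Suc k"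
      by (simp add: diff_divide_distrib[symmetric] del: power_Suc of_nat_Suc)
    then show ?case
      using power_inject_base less_prob_bounds by blast
  qed
qed

text \<open>Where \<open>less_prob\<close> agrees at \<open>y\<close> for both bounds, the event
  \<open>w - u < y \<le> w - l\<close> is null. This is used along points \<open>y n \<ge> m\<close>
  tending to \<open>m\<close>: if \<open>w\<close> were strictly between \<open>m + l\<close> and
  \<open>m + u\<close>, some \<open>y n\<close> would fall between \<open>w - u\<close> and
  \<open>w - l\<close>.\<close>

lemma AE_gap_null:
  "AE z in \<Lambda>. AE t in \<omega>. \<not> (m + fst z < t \<and> t < m + snd z)"
proof -
  \<comment> \<open>The agreement holds only \<xi>-almost everywhere, and \<open>m\<close> need not
    be an atom, so points near \<open>m\<close> replace \<open>m\<close> itself.\<close>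
  have "\<exists>y. m \<le> y \<and> y < m + e \<and> less_prob fst y = less_prob snd y" if "e > 0" for e
  proof (rule ccontr)
    assume none: "\<not> ?thesis"
    have "AE t in \<xi>. \<not> (t < m + e)"
      using AE_less_prob_eq xi_ge by eventually_elim (use none in auto)
    then have "measure \<xi> {..<m + e} = 0"
      by (subst (asm) \<xi>.AE_iff_measure_0) (auto simp: lessThan_def)
    with xi_near[OF that] show False by simp
  qed
  then have "\<exists>y. \<forall>n. m \<le> y n \<and> y n < m + inverse (real (Suc n)) \<and> less_prob fst (y n) = less_prob snd (y n)"
    by (intro choice) simp
  then obtain y where y: "\<And>n. m \<le> y n" "\<And>n. y n < m + inverse (real (Suc n))"
    "\<And>n. less_prob fst (y n) = less_prob snd (y n)" by blast
  have "AE p in \<rho>. \<not> (fst p - snd (snd p) < y n \<and> y n \<le> fst p - fst (snd p))" for n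
  proof -
    let ?A = "{p. fst p - fst (snd p) < y n}" and ?B = "{p. fst p - snd (snd p) < y n}"
    have "measure \<rho> (?B - ?A) = measure \<rho> ?B - measure \<rho> (?A \<inter> ?B)"
      using \<rho>.finite_measure_Diff'[of ?B ?A] less_set_rho by (simp add: Int_commute)
    also have "measure \<rho> (?A \<inter> ?B) = measure \<rho> ?A"
    proof (rule \<rho>.finite_measure_eq_AE)
      show "AE p in \<rho>. (p \<in> ?A \<inter> ?B) = (p \<in> ?A)"
        using AE_rho_bounds by eventually_elim auto
    qed (use less_set_rho in auto)
    also have "measure \<rho> ?B - measure \<rho> ?A = 0"
      using y(3)[of n] by (simp add: less_prob_def)
    finally have "emeasure \<rho> (?B - ?A) = 0"
      by (simp add: \<rho>.emeasure_eq_measure)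
    then show ?thesis
      using less_set_rho by (intro AE_I'[of "?B - ?A"]) (auto simp: null_sets_def)
  qed
  then have "AE p in \<rho>. \<forall>n. \<not> (fst p - snd (snd p) < y n \<and> y n \<le> fst p - fst (snd p))"
    unfolding AE_all_countable by blast
  then have "AE p in \<rho>. \<not> (m + fst (snd p) < fst p \<and> fst p < m + snd (snd p))"
  proof eventually_elim
    case (elim p)
    show ?case
    proof
      assume *: "m + fst (snd p) < fst p \<and> fst p < m + snd (snd p)"
      then obtain n where "inverse (real (Suc n)) < fst p - fst (snd p) - m"
        using reals_Archimedean[of "fst p - fst (snd p) - m"] by auto
      then have "y n \<le> fst p - fst (snd p)" "fst p - snd (snd p) < y n"
        using y(1,2)[of n] * by auto
      with elim show False by blast
    qed
  qed
  then have "AE w in \<omega>. AE z in \<Lambda>. \<not> (m + fst z < w \<and> w < m + snd z)"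
    using \<omega>\<Lambda>.AE_pair[of "\<lambda>p. \<not> (m + fst (snd p) < fst p \<and> fst p < m + snd (snd p))"] by simp
  moreover have "{p. \<not> (m + fst (snd p) < fst p \<and> fst p < m + snd (snd p))} \<in> sets (borel \<Otimes>\<^sub>M (borel \<Otimes>\<^sub>M borel))"
    by (rule Collect_in_sets) (measurable, simp add: space_pair_measure)
  ultimately show ?thesis
    by (subst (asm) \<omega>\<Lambda>.AE_commute) (auto simp: sets_rho)
qed

section \<open>Pairs of different bounds\<close>

abbreviation "bad z \<equiv> fst z < (snd z :: real)"

text \<open>If \<open>l < u\<close>, then \<open>u\<close> is not the vertex weight but the term of
  a child, whence \<open>u + m \<le> top_w\<close>. If moreover \<open>u > a - m\<close>, the gap
  \<open>(m + l, m + u)\<close> contains an interval between \<open>a\<close> and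
  \<open>top_w\<close>, which \<omega> charges, against \<open>AE_gap_null\<close>.\<close>

lemma AE_bad_le: "AE z in \<Lambda>. bad z \<longrightarrow> snd z \<le> a - m"
proof -
  have ch: "AE \<zeta> in P. \<forall>i<K \<zeta>. ereal (W i \<zeta>) \<le> top_w \<and> m \<le> fst (C i \<zeta>)"
  proof -
    have "AE p in \<rho>. ereal (fst p) \<le> top_w \<and> m \<le> fst (snd p)"
    proof (rule \<omega>\<Lambda>.AE_pair_measure)
      have "{p. ereal (fst p) \<le> top_w \<and> m \<le> fst (snd p)} \<in> sets (borel \<Otimes>\<^sub>M (borel \<Otimes>\<^sub>M borel))"
        by (rule Collect_in_sets) (measurable, simp add: space_pair_measure)
      then show "{p \<in> space \<rho>. ereal (fst p) \<le> top_w \<and> m \<le> fst (snd p)} \<in> sets \<rho>"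
        by (simp add: sets_rho)
      show "AE w in \<omega>. AE z in \<Lambda>. ereal (fst (w, z)) \<le> top_w \<and> m \<le> fst (snd (w, z))"
        using omega_le by eventually_elim (use bounds in \<open>auto elim!: eventually_mono\<close>)
    qed
    moreover have "Measurable.pred (borel \<Otimes>\<^sub>M (borel \<Otimes>\<^sub>M borel)) (\<lambda>p. ereal (fst p) \<le> top_w \<and> m \<le> fst (snd p))"
      by measurable
    ultimately show ?thesis
      using AE_children[of "\<lambda>p. ereal (fst p) \<le> top_w \<and> m \<le> fst (snd p)"] by simp
  qed
  have "AE \<zeta> in P. bad (Y \<zeta>) \<longrightarrow> ereal (snd (Y \<zeta>) + m) \<le> top_w"
    using ch lower_eq upper_eq
  proof eventually_elim
    case (elim \<zeta>)
    show ?case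
    proof
      assume bad: "bad (Y \<zeta>)"
      have "X \<zeta> \<le> fst (Y \<zeta>)" by (simp add: elim(2))
      moreover have "snd (Y \<zeta>) \<in> insert (X \<zeta>) ((\<lambda>i. W i \<zeta> - fst (C i \<zeta>)) ` {..<K \<zeta>})"
        unfolding elim(3) by (rule Max_in) auto
      ultimately obtain i where i: "i < K \<zeta>" "snd (Y \<zeta>) = W i \<zeta> - fst (C i \<zeta>)"
        using bad by auto
      with elim(1) have "ereal (snd (Y \<zeta>) + m) \<le> ereal (W i \<zeta>)" "ereal (W i \<zeta>) \<le> top_w" by auto
      then show "ereal (snd (Y \<zeta>) + m) \<le> top_w" by (rule order.trans)
    qed
  qed
  then have "AE z in \<Lambda>. bad z \<longrightarrow> ereal (snd z + m) \<le> top_w"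
    by (subst AE_law_iff) auto
  with AE_gap_null show ?thesis
  proof eventually_elim
    case (elim z)
    show ?case
    proof (rule ccontr)
      assume "\<not> ?thesis"
      then have z: "bad z" "a < m + snd z" "ereal (m + snd z) \<le> top_w"
        using elim(2) by (auto simp: add.commute)
      have pos: "measure \<omega> {max a (m + fst z)<..<m + snd z} > 0"
        using z by (intro omega_pos) auto
      have "AE t in \<omega>. \<not> t \<in> {max a (m + fst z)<..<m + snd z}"
        using elim(1) by eventually_elim auto
      then have "measure \<omega> {max a (m + fst z)<..<m + snd z} = 0"
        by (subst (asm) \<omega>.AE_iff_measure_0) (measurable, simp del: greaterThanLessThan_iff)
      with pos show False by simp
    qed
  qed
qed

text \<open>An event of positive probability meets every almost sure one, so a single sample can
  satisfy all constraints and the final argument becomes deterministic. \<open>Q\<close> holds for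
  the children as well as for the parent, because all have law \<open>\<Lambda>\<close>.\<close>

lemma exists_sample:
  assumes S[measurable]: "Measurable.pred (borel \<Otimes>\<^sub>M borel) S" and posS: "measure \<Lambda> {z. S z} > 0"
    and posw: "measure \<omega> {c<..<d} > 0" and e: "e > 0"
    and Q: "AE z in \<Lambda>. Q z" and Qm[measurable]: "Measurable.pred (borel \<Otimes>\<^sub>M borel) Q"
    and k: "pmf q k > 0"
  obtains t w z l u where "t < m + e" "\<And>i. i < k \<Longrightarrow> c < w i \<and> w i < d \<and> S (z i) \<and> Q (z i)" "Q (l, u)"
    "l = Max (insert t ((\<lambda>i. w i - snd (z i)) ` {..<k}))"
    "u = Max (insert t ((\<lambda>i. w i - fst (z i)) ` {..<k}))"
proof -
  have setS: "{z. S z} \<in> sets (borel \<Otimes>\<^sub>M borel)"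
    by (rule Collect_in_sets) (measurable, simp add: space_pair_measure)
  have "{c<..<d} \<times> {z. S z} \<in> sets (borel \<Otimes>\<^sub>M (borel \<Otimes>\<^sub>M borel))"
    using setS by (intro pair_measureI) auto
  moreover have "measure \<rho> ({c<..<d} \<times> {z. S z}) = measure \<omega> {c<..<d} * measure \<Lambda> {z. S z}"
    using setS by (simp add: measure_def \<Lambda>.emeasure_pair_measure_Times enn2real_mult)
  ultimately have "prob {\<zeta> \<in> space P. K \<zeta> = k \<and> X \<zeta> \<in> {..<m + e} \<and>
      (\<forall>i<k. (W i \<zeta>, C i \<zeta>) \<in> {c<..<d} \<times> {z. S z})} > 0"
    using k posS posw xi_near[OF e] by (subst joint) auto
  moreover define E where
    "E \<zeta> \<longleftrightarrow> K \<zeta> = k \<and> X \<zeta> < m + e \<and> (\<forall>i<k. c < W i \<zeta> \<and> W i \<zeta> < d \<and> S (C i \<zeta>))" for \<zeta>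
  ultimately have "prob {\<zeta> \<in> space P. E \<zeta>} > 0"
    by (auto elim!: back_subst[where P = "\<lambda>A. 0 < prob A"])
  moreover have "Measurable.pred P E"
    unfolding E_def by measurable
  ultimately have np: "\<not> (AE \<zeta> in P. \<not> E \<zeta>)"
    by (subst AE_iff_measure_0) auto
  have ch: "AE \<zeta> in P. \<forall>i<K \<zeta>. Q (C i \<zeta>)"
  proof -
    have "AE p in \<rho>. Q (snd p)"
    proof (rule \<omega>\<Lambda>.AE_pair_measure)
      have "{p. Q (snd p)} \<in> sets (borel \<Otimes>\<^sub>M (borel \<Otimes>\<^sub>M borel))"
        by (rule Collect_in_sets) (measurable, simp add: space_pair_measure)
      then show "{p \<in> space \<rho>. Q (snd p)} \<in> sets \<rho>" by (simp add: sets_rho)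
    qed (use Q in simp)
    moreover have "Measurable.pred (borel \<Otimes>\<^sub>M (borel \<Otimes>\<^sub>M borel)) (\<lambda>p. Q (snd p))"
      by measurable
    ultimately show ?thesis using AE_children[of "\<lambda>p. Q (snd p)"] by simp
  qed
  have QY: "AE \<zeta> in P. Q (Y \<zeta>)"
    using Q Qm by (simp add: AE_law_iff)
  have "\<exists>\<zeta>. E \<zeta> \<and> (\<forall>i<K \<zeta>. Q (C i \<zeta>)) \<and> Q (Y \<zeta>) \<and>
      fst (Y \<zeta>) = Max (insert (X \<zeta>) ((\<lambda>i. W i \<zeta> - snd (C i \<zeta>)) ` {..<K \<zeta>})) \<and>
      snd (Y \<zeta>) = Max (insert (X \<zeta>) ((\<lambda>i. W i \<zeta> - fst (C i \<zeta>)) ` {..<K \<zeta>}))"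
  proof (rule ccontr)
    assume none: "\<not> ?thesis"
    have "AE \<zeta> in P. \<not> E \<zeta>"
      using ch QY lower_eq upper_eq by eventually_elim (use none in blast)
    with np show False ..
  qed
  then obtain \<zeta> where \<zeta>: "E \<zeta>" "\<forall>i<K \<zeta>. Q (C i \<zeta>)" "Q (Y \<zeta>)"
    "fst (Y \<zeta>) = Max (insert (X \<zeta>) ((\<lambda>i. W i \<zeta> - snd (C i \<zeta>)) ` {..<K \<zeta>}))"
    "snd (Y \<zeta>) = Max (insert (X \<zeta>) ((\<lambda>i. W i \<zeta> - fst (C i \<zeta>)) ` {..<K \<zeta>}))"
    by blast
  have [simp]: "K \<zeta> = k" using \<zeta>(1) by (simp add: E_def)
  show ?thesis
  proof (rule that[of "X \<zeta>" "\<lambda>i. W i \<zeta>" "\<lambda>i. C i \<zeta>" "fst (Y \<zeta>)" "snd (Y \<zeta>)"])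
    show "Q (fst (Y \<zeta>), snd (Y \<zeta>))" using \<zeta>(3) by simp
    show "fst (Y \<zeta>) = Max (insert (X \<zeta>) ((\<lambda>i. W i \<zeta> - snd (C i \<zeta>)) ` {..<k}))"
      using \<zeta>(4) by simp
    show "snd (Y \<zeta>) = Max (insert (X \<zeta>) ((\<lambda>i. W i \<zeta> - fst (C i \<zeta>)) ` {..<k}))"
      using \<zeta>(5) by simp
  qed (use \<zeta>(1,2) in \<open>auto simp: E_def\<close>)
qed

text \<open>Replacing \<open>snd\<close> by \<open>fst\<close> strictly raises every child's term.
  The condition on \<open>t\<close> keeps the vertex weight from being the maximum on both
  sides.\<close>

lemma bad_Max:
  fixes k :: nat
  assumes "k > 0" "\<And>i. i < k \<Longrightarrow> bad (z i)" "t < w 0 - fst (z 0)"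
  shows "Max (insert t ((\<lambda>i. w i - snd (z i)) ` {..<k})) < Max (insert t ((\<lambda>i. w i - fst (z i)) ` {..<k}))"
proof (subst Max_less_iff)
  let ?U = "insert t ((\<lambda>i. w i - fst (z i)) ` {..<k})"
  have *: "w i - fst (z i) \<le> Max ?U" if "i < k" for i
    using that by (intro Max_ge) auto
  show "\<forall>r\<in>insert t ((\<lambda>i. w i - snd (z i)) ` {..<k}). r < Max ?U"
  proof
    fix r assume "r \<in> insert t ((\<lambda>i. w i - snd (z i)) ` {..<k})"
    then consider "r = t" | i where "i < k" "r = w i - snd (z i)" by auto
    then show "r < Max ?U"
    proof cases
      case 1
      then show ?thesis using assms(1,3) *[of 0] by linarith
    next
      case 2
      then show ?thesis using assms(2)[of i] *[of i] by linarith
    qed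
  qed
qed auto

text \<open>Let \<open>l\<^sub>0\<close> and \<open>u\<^sub>0\<close> be the essential extremes of the bounds where they differ. Children
  near \<open>l\<^sub>0\<close> with weights near the maximum give \<open>top_w \<le> u\<^sub>0 + l\<^sub>0\<close>; children near \<open>u\<^sub>0\<close> with
  weights near \<open>a\<close> then produce a lower bound smaller than \<open>l\<^sub>0\<close>.\<close>

theorem AE_bounds_coincide: "AE z in \<Lambda>. fst z = snd z"
proof (rule ccontr)
  assume neq: "\<not> ?thesis"
  have bad: "\<not> (AE z in \<Lambda>. \<not> bad z)"
  proof
    assume "AE z in \<Lambda>. \<not> bad z"
    with bounds have "AE z in \<Lambda>. fst z = snd z" by eventually_elim auto
    with neq show False ..
  qed
  have bad_pred: "Measurable.pred \<Lambda> bad" by measurable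
  \<comment> \<open>Without children both bounds equal the vertex weight, so different bounds
    require a positive offspring number of positive probability.\<close>
  obtain k where k: "k > 0" "pmf q k > 0"
  proof -
    have "\<exists>k>0. pmf q k > 0"
    proof (rule ccontr)
      assume "\<not> ?thesis"
      then have "pmf q k = 0" if "k > 0" for k
        using that pmf_nonneg[of q k] by (metis less_le)
      then have "prob {\<zeta> \<in> space P. K \<zeta> = k} = 0" if "k > 0" for k
        using joint[OF _ sets.top, of UNIV k] that by (simp add: space_pair_measure)
      then have "AE \<zeta> in P. K \<zeta> \<noteq> k" if "k > 0" for k
        using that by (subst AE_iff_measure_0) auto
      then have "AE \<zeta> in P. \<forall>k. k > 0 \<longrightarrow> K \<zeta> \<noteq> k"
        unfolding AE_all_countable by auto
      then have "AE \<zeta> in P. \<not> bad (Y \<zeta>)"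
        using lower_eq upper_eq
      proof eventually_elim
        case (elim \<zeta>)
        then have "K \<zeta> = 0" by (cases "K \<zeta>") auto
        with elim show ?case by simp
      qed
      then have "AE z in \<Lambda>. \<not> bad z"
        by (subst AE_law_iff) measurable
      with bad show False ..
    qed
    with that show ?thesis by blast
  qed
  obtain l0 where l0: "AE z in \<Lambda>. bad z \<longrightarrow> l0 \<le> fst z"
    and l0_near: "\<And>e. e > 0 \<Longrightarrow> measure \<Lambda> {z \<in> space \<Lambda>. bad z \<and> fst z < l0 + e} > 0"
    by (rule \<Lambda>.ess_inf_on_exists[OF _ bad_pred bad, of fst m]) (use bounds in \<open>auto elim!: eventually_mono\<close>)
  \<comment> \<open>The essential supremum of \<open>snd\<close> is obtained by negation;
    \<open>AE_bad_le\<close> provides the bound that makes it finite.\<close>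
  obtain u0' where u0': "AE z in \<Lambda>. bad z \<longrightarrow> u0' \<le> - snd z"
    and u0'_near: "\<And>e. e > 0 \<Longrightarrow> measure \<Lambda> {z \<in> space \<Lambda>. bad z \<and> - snd z < u0' + e} > 0"
    by (rule \<Lambda>.ess_inf_on_exists[OF _ bad_pred bad, of "\<lambda>z. - snd z" "m - a"])
      (use AE_bad_le in \<open>auto elim!: eventually_mono\<close>)
  define u0 where "u0 = - u0'"
  define Q where "Q z \<longleftrightarrow> (bad z \<longrightarrow> l0 \<le> fst z \<and> snd z \<le> u0 \<and> snd z \<le> a - m)" for z
  have Q: "AE z in \<Lambda>. Q z"
    using l0 u0' AE_bad_le by eventually_elim (auto simp: Q_def u0_def)
  have Qm: "Measurable.pred (borel \<Otimes>\<^sub>M borel) Q"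
    unfolding Q_def by measurable
  have top_le: "c \<le> u0 + l0" if c: "a < c" "ereal c < top_w" for c
  proof (rule field_le_epsilon)
    fix e :: real assume "e > 0"
    \<comment> \<open>A bad child has \<open>fst z < a - m\<close>, so with a weight above
      \<open>c\<close> its term exceeds \<open>m + (c - a)\<close>. The cap \<open>c - a\<close>
      keeps the vertex weight below that term.\<close>
    define e' where "e' = min e (c - a)"
    have e': "e' > 0" "e' \<le> e" "e' \<le> c - a" using \<open>e > 0\<close> c by (auto simp: e'_def)
    obtain d where d: "c < d" "ereal d \<le> top_w"
      using ereal_dense2[OF c(2)] by (auto intro: less_imp_le)
    have Sm: "Measurable.pred (borel \<Otimes>\<^sub>M borel) (\<lambda>z. bad z \<and> fst z < l0 + e')" by measurable
    have Spos: "measure \<Lambda> {z. bad z \<and> fst z < l0 + e'} > 0" using l0_near[OF e'(1)] by simp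
    have wpos: "measure \<omega> {c<..<d} > 0" using c d by (intro omega_pos) auto
    obtain t w z l u where s: "t < m + e'"
        "\<And>i. i < k \<Longrightarrow> c < w i \<and> w i < d \<and> (bad (z i) \<and> fst (z i) < l0 + e') \<and> Q (z i)" "Q (l, u)"
      "l = Max (insert t ((\<lambda>i. w i - snd (z i)) ` {..<k}))"
      "u = Max (insert t ((\<lambda>i. w i - fst (z i)) ` {..<k}))"
      by (rule exists_sample[OF Sm Spos wpos e'(1) Q Qm k(2)]) (rule that)
    have "t < w 0 - fst (z 0)"
      using s(1) s(2)[OF k(1)] e' by (auto simp: Q_def)
    then have "bad (l, u)"
      unfolding s(4,5) fst_conv snd_conv using s(2) k(1) by (intro bad_Max) auto
    with s(3) have "u \<le> u0" by (simp add: Q_def)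
    moreover have "w 0 - fst (z 0) \<le> u"
      unfolding s(5) using k(1) by (intro Max_ge) auto
    ultimately show "c \<le> u0 + l0 + e"
      using s(2)[OF k(1)] e' by auto
  qed
  obtain b where b: "a < b" "ereal b < top_w"
    using ereal_dense2[OF a_less] by auto
  \<comment> \<open>Three error terms share \<open>b - a\<close>: the offset \<open>a + e\<close>
    that lifts the children's terms above \<open>t < m + e\<close>, the width of the weight
    interval, and the distance of \<open>snd\<close> from \<open>u0\<close>. A child's term in
    \<open>l\<close> is then below \<open>a + 2 * e - (u0 - e) = b - u0 \<le> l0\<close>.\<close>
  define e where "e = (b - a) / 3"
  have e: "e > 0" "a + 3 * e = b" using b(1) by (simp_all add: e_def field_simps)
  have b_le: "b \<le> u0 + l0" by (rule top_le) fact+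
  have top_e: "ereal (a + 2 * e) \<le> top_w"
    using b e by (intro order.trans[OF _ less_imp_le[OF b(2)]]) auto
  have Sm: "Measurable.pred (borel \<Otimes>\<^sub>M borel) (\<lambda>z. bad z \<and> - snd z < u0' + e)" by measurable
  have Spos: "measure \<Lambda> {z. bad z \<and> - snd z < u0' + e} > 0" using u0'_near[OF e(1)] by simp
  have wpos: "measure \<omega> {a + e<..<a + 2 * e} > 0" using e(1) top_e by (intro omega_pos) auto
  obtain t w z l u where s: "t < m + e"
      "\<And>i. i < k \<Longrightarrow> a + e < w i \<and> w i < a + 2 * e \<and> (bad (z i) \<and> - snd (z i) < u0' + e) \<and> Q (z i)" "Q (l, u)"
    "l = Max (insert t ((\<lambda>i. w i - snd (z i)) ` {..<k}))"
    "u = Max (insert t ((\<lambda>i. w i - fst (z i)) ` {..<k}))"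
    by (rule exists_sample[OF Sm Spos wpos e(1) Q Qm k(2)]) (rule that)
  have "t < w 0 - fst (z 0)"
    using s(1) s(2)[OF k(1)] by (auto simp: Q_def)
  then have "bad (l, u)"
    unfolding s(4,5) fst_conv snd_conv using s(2) k(1) by (intro bad_Max) auto
  with s(3) have "l0 \<le> l" by (simp add: Q_def)
  moreover have "l \<in> insert t ((\<lambda>i. w i - snd (z i)) ` {..<k})"
    unfolding s(4) by (rule Max_in) auto
  moreover have "u0 \<le> a - m + e"
    using s(2)[OF k(1)] by (auto simp: Q_def u0_def)
  \<comment> \<open>Here \<open>l0 \<ge> b - u0 \<ge> m + 2 * e\<close>, whereas
    \<open>t < m + e\<close>.\<close>
  moreover have "l \<noteq> t" if "l0 \<le> l" "u0 \<le> a - m + e"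
    using that b_le e s(1) by auto
  ultimately obtain i where "i < k" "l = w i - snd (z i)" "l0 \<le> l"
    by auto
  then show False
    using s(2)[of i] b_le e by (auto simp: u0_def)
qed

end


section \<open>Support of a law\<close>

text \<open>The complement of the support is a union of null open sets; by the Lindelof property
  countably many of them suffice.\<close>

lemma AE_in_measure_support:
  assumes "real_distribution \<mu>"
  shows "AE t in \<mu>. t \<in> measure_support \<mu>"
proof -
  interpret real_distribution \<mu> by fact
  define F where "F = {U. open U \<and> measure \<mu> U = 0}"
  obtain F' where F': "F' \<subseteq> F" "countable F'" "\<Union>F' = \<Union>F"
    using Lindelof[of F] by (auto simp: F_def)
  have "- measure_support \<mu> = \<Union>F"
    by (auto simp: measure_support_def F_def zero_less_measure_iff)
  moreover have "(\<Union>U\<in>F'. U) \<in> null_sets \<mu>"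
    using F'(1,2) by (intro null_sets_UN' null_setsI) (auto simp: F_def emeasure_eq_measure subset_iff)
  ultimately have "- measure_support \<mu> \<in> null_sets \<mu>"
    using F'(3) by simp
  then show ?thesis
    by (rule AE_I') auto
qed

lemma law_min_le:
  assumes "real_distribution \<mu>" "bdd_below (measure_support \<mu>)"
  shows "AE t in \<mu>. law_min \<mu> \<le> t"
  using AE_in_measure_support[OF assms(1)]
  by eventually_elim (auto simp: law_min_def intro: cInf_lower assms(2))

lemma measure_near_law_min:
  assumes "real_distribution \<mu>" "bdd_below (measure_support \<mu>)" "e > 0"
  shows "measure \<mu> {..<law_min \<mu> + e} > 0"
proof -
  interpret real_distribution \<mu> by fact
  have "measure_support \<mu> \<noteq> {}"
    using AE_in_measure_support[OF assms(1)] by auto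
  then obtain t where "t \<in> measure_support \<mu>" "t < law_min \<mu> + e"
    using cInf_less_iff[of "measure_support \<mu>" "law_min \<mu> + e"] assms(2,3) by (auto simp: law_min_def)
  then show ?thesis by (auto simp: measure_support_def)
qed

lemma le_law_max:
  assumes "real_distribution \<mu>"
  shows "AE t in \<mu>. ereal t \<le> law_max \<mu>"
  using AE_in_measure_support[OF assms]
  by eventually_elim (auto simp: law_max_def intro: Sup_upper)

lemma measure_interval_pos:
  assumes "{t. a < t \<and> ereal t < law_max \<mu>} \<subseteq> measure_support \<mu>"
    and "a \<le> c" "c < d" "ereal d \<le> law_max \<mu>"
  shows "measure \<mu> {c<..<d} > 0"
proof -
  obtain t where t: "c < t" "t < d" using dense[OF assms(3)] by blast
  then have "ereal t < law_max \<mu>" using assms(4) by (meson less_ereal.simps(1) less_le_trans)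
  with t assms(1,2) have "t \<in> measure_support \<mu>" by auto
  with t show ?thesis by (auto simp: measure_support_def)
qed


section \<open>The product space of a subtree\<close>

text \<open>The coordinates are the offspring numbers, the weights of the edges to the children and the
  vertex weights of a subtree, with words read relative to its root.\<close>

type_synonym coord = "vertex + (vertex \<times> nat) + vertex"

fun push :: "vertex \<Rightarrow> coord \<Rightarrow> coord" where
  "push v (Inl y) = Inl (v @ y)"
| "push v (Inr (Inl (y, i))) = Inr (Inl (v @ y, i))"
| "push v (Inr (Inr y)) = Inr (Inr (v @ y))"

lemma push_inject: "push v j = push v' j' \<Longrightarrow> length v = length v' \<Longrightarrow> v = v' \<and> j = j'"
  by (cases "(v, j)" rule: push.cases; cases "(v', j')" rule: push.cases) auto

definition subtree :: "vertex \<Rightarrow> (coord \<Rightarrow> real) \<Rightarrow> coord \<Rightarrow> real" where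
  "subtree v \<zeta> = (\<lambda>j. \<zeta> (push v j))"

text \<open>All coordinates are real so that one product space carries them; the floor recovers an
  embedded natural number.\<close>

definition offspring :: "(coord \<Rightarrow> real) \<Rightarrow> vertex \<Rightarrow> nat" where
  "offspring \<zeta> y = nat \<lfloor>\<zeta> (Inl y)\<rfloor>"

definition edge_weight :: "(coord \<Rightarrow> real) \<Rightarrow> vertex \<Rightarrow> nat \<Rightarrow> real" where
  "edge_weight \<zeta> y i = \<zeta> (Inr (Inl (y, i)))"

definition vertex_weight :: "(coord \<Rightarrow> real) \<Rightarrow> vertex \<Rightarrow> real" where
  "vertex_weight \<zeta> y = \<zeta> (Inr (Inr y))"

definition Lo where
  "Lo m \<zeta> = lower_limit (offspring \<zeta>) (edge_weight \<zeta>) (vertex_weight \<zeta>) m []"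

definition Up where
  "Up m \<zeta> = upper_limit (offspring \<zeta>) (edge_weight \<zeta>) (vertex_weight \<zeta>) m []"

text \<open>Both limits are finite as soon as all vertex weights are at least \<open>m\<close>, so
  the conversion to reals loses nothing there.\<close>

definition bounds_pair where
  "bounds_pair m \<zeta> = (real_of_ereal (Lo m \<zeta>), real_of_ereal (Up m \<zeta>))"

lemma subtree_simps:
  "offspring (subtree v \<zeta>) y = offspring \<zeta> (v @ y)"
  "edge_weight (subtree v \<zeta>) y i = edge_weight \<zeta> (v @ y) i"
  "vertex_weight (subtree v \<zeta>) y = vertex_weight \<zeta> (v @ y)"
  by (simp_all add: subtree_def offspring_def edge_weight_def vertex_weight_def)

lemma Lo_subtree:
  "lower_limit (offspring \<zeta>) (edge_weight \<zeta>) (vertex_weight \<zeta>) m v = Lo m (subtree v \<zeta>)"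
  using lower_limit_shift[of "offspring \<zeta>" "edge_weight \<zeta>" "vertex_weight \<zeta>" m v "[]"]
  by (simp add: Lo_def subtree_simps[abs_def])

lemma Up_subtree:
  "upper_limit (offspring \<zeta>) (edge_weight \<zeta>) (vertex_weight \<zeta>) m v = Up m (subtree v \<zeta>)"
  using upper_limit_shift[of "offspring \<zeta>" "edge_weight \<zeta>" "vertex_weight \<zeta>" m v "[]"]
  by (simp add: Up_def subtree_simps[abs_def])

lemma max_SUP_ereal_eq_Max:
  fixes k :: nat
  shows
  "max (ereal t) (SUP i\<in>{..<k}. ereal (f i)) = ereal (Max (insert t (f ` {..<k})))"
proof (induction k)
  case (Suc k)
  have "max (ereal t) (SUP i\<in>{..<Suc k}. ereal (f i)) =
      max (ereal (f k)) (max (ereal t) (SUP i\<in>{..<k}. ereal (f i)))"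
    by (simp add: lessThan_Suc sup_max max.left_commute)
  also have "\<dots> = ereal (max (f k) (Max (insert t (f ` {..<k}))))"
    by (simp only: Suc.IH ereal_max)
  also have "max (f k) (Max (insert t (f ` {..<k}))) = Max (insert (f k) (insert t (f ` {..<k})))"
    by (subst (2) Max_insert) auto
  also have "insert (f k) (insert t (f ` {..<k})) = insert t (f ` {..<Suc k})"
    by (auto simp: lessThan_Suc)
  finally show ?case .
qed (simp add: bot_ereal_def)

lemma bounds_pair_facts:
  assumes m: "\<And>v. m \<le> vertex_weight \<zeta> v"
  shows ereal_fst_bounds_pair: "ereal (fst (bounds_pair m \<zeta>)) = Lo m \<zeta>"
    and ereal_snd_bounds_pair: "ereal (snd (bounds_pair m \<zeta>)) = Up m \<zeta>"
    and bounds_pair_ge: "m \<le> fst (bounds_pair m \<zeta>)"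
    and bounds_pair_le: "fst (bounds_pair m \<zeta>) \<le> snd (bounds_pair m \<zeta>)"
proof -
  have le: "ereal m \<le> Lo m \<zeta>" "Lo m \<zeta> \<le> Up m \<zeta>" "Up m \<zeta> < \<infinity>"
    using limits_bounds[of m "vertex_weight \<zeta>", OF m] by (auto simp: Lo_def Up_def)
  show l: "ereal (fst (bounds_pair m \<zeta>)) = Lo m \<zeta>"
    using le by (cases "Lo m \<zeta>"; cases "Up m \<zeta>") (auto simp: bounds_pair_def)
  show u: "ereal (snd (bounds_pair m \<zeta>)) = Up m \<zeta>"
    using le by (cases "Lo m \<zeta>"; cases "Up m \<zeta>") (auto simp: bounds_pair_def)
  show "m \<le> fst (bounds_pair m \<zeta>)" "fst (bounds_pair m \<zeta>) \<le> snd (bounds_pair m \<zeta>)"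
    using le unfolding l[symmetric] u[symmetric] by auto
qed

lemma bounds_pair_rec:
  assumes m: "\<And>v. m \<le> vertex_weight \<zeta> v"
  shows "fst (bounds_pair m \<zeta>) = Max (insert (vertex_weight \<zeta> [])
      ((\<lambda>i. edge_weight \<zeta> [] i - snd (bounds_pair m (subtree [i] \<zeta>))) ` {..<offspring \<zeta> []}))"
    and "snd (bounds_pair m \<zeta>) = Max (insert (vertex_weight \<zeta> [])
      ((\<lambda>i. edge_weight \<zeta> [] i - fst (bounds_pair m (subtree [i] \<zeta>))) ` {..<offspring \<zeta> []}))"
proof -
  have s: "m \<le> vertex_weight (subtree v \<zeta>) y" for v y
    using m by (simp add: subtree_simps)
  have "ereal (fst (bounds_pair m \<zeta>)) = max (ereal (vertex_weight \<zeta> []))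
     (SUP i\<in>{..<offspring \<zeta> []}. ereal (edge_weight \<zeta> [] i - snd (bounds_pair m (subtree [i] \<zeta>))))"
    unfolding ereal_fst_bounds_pair[OF m]
    using limits_fixed_point(1)[of m "vertex_weight \<zeta>" "offspring \<zeta>" "edge_weight \<zeta>" "[]", OF m]
    by (simp add: Lo_def[symmetric] Up_subtree ereal_snd_bounds_pair[OF s, symmetric])
  then show "fst (bounds_pair m \<zeta>) = Max (insert (vertex_weight \<zeta> [])
      ((\<lambda>i. edge_weight \<zeta> [] i - snd (bounds_pair m (subtree [i] \<zeta>))) ` {..<offspring \<zeta> []}))"
    unfolding max_SUP_ereal_eq_Max by simp
  have "ereal (snd (bounds_pair m \<zeta>)) = max (ereal (vertex_weight \<zeta> []))
     (SUP i\<in>{..<offspring \<zeta> []}. ereal (edge_weight \<zeta> [] i - fst (bounds_pair m (subtree [i] \<zeta>))))"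
    unfolding ereal_snd_bounds_pair[OF m]
    using limits_fixed_point(2)[of m "vertex_weight \<zeta>" "offspring \<zeta>" "edge_weight \<zeta>" "[]", OF m]
    by (simp add: Up_def[symmetric] Lo_subtree ereal_fst_bounds_pair[OF s, symmetric])
  then show "snd (bounds_pair m \<zeta>) = Max (insert (vertex_weight \<zeta> [])
      ((\<lambda>i. edge_weight \<zeta> [] i - fst (bounds_pair m (subtree [i] \<zeta>))) ` {..<offspring \<zeta> []}))"
    unfolding max_SUP_ereal_eq_Max by simp
qed

section \<open>Measurability of the bounds in the coordinates\<close>

abbreviation "coord_space \<equiv> PiM (UNIV :: coord set) (\<lambda>_. borel :: real measure)"

lemma measurable_coord[measurable]: "(\<lambda>\<zeta>. \<zeta> j) \<in> borel_measurable coord_space"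
  by (rule measurable_component_singleton) simp

lemma measurable_offspring[measurable]: "(\<lambda>\<zeta>. offspring \<zeta> y) \<in> measurable coord_space (count_space UNIV)"
  unfolding offspring_def by measurable

lemma measurable_edge_weight_coord[measurable]: "(\<lambda>\<zeta>. edge_weight \<zeta> y i) \<in> borel_measurable coord_space"
  unfolding edge_weight_def by measurable

lemma measurable_vertex_weight_coord[measurable]: "(\<lambda>\<zeta>. vertex_weight \<zeta> y) \<in> borel_measurable coord_space"
  unfolding vertex_weight_def by measurable

lemma measurable_bnd[measurable]:
  "(\<lambda>\<zeta>. bnd (offspring \<zeta>) (edge_weight \<zeta>) (vertex_weight \<zeta>) m b n v) \<in> borel_measurable coord_space"
proof (induction n arbitrary: b v)
  case (Suc n)
  note Suc.IH[measurable]
  show ?case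
    unfolding bnd.simps lessThan_def SUP_Collect_ereal by measurable
qed simp

lemma measurable_bounds_pair[measurable]: "bounds_pair m \<in> measurable coord_space (borel \<Otimes>\<^sub>M borel)"
  unfolding bounds_pair_def[abs_def] Lo_def Up_def lower_limit_def upper_limit_def by measurable

text \<open>Every offspring number has law \<open>q\<close>, including that of the subtree's own
  root; this makes the law self-similar.\<close>

locale subtree_law =
  fixes q :: "nat pmf" and \<omega> \<xi> :: "real measure"
  assumes omega: "real_distribution \<omega>" and xi: "real_distribution \<xi>"
begin

definition coord_law :: "coord \<Rightarrow> real measure" where
  "coord_law = case_sum (\<lambda>_. distr (measure_pmf q) borel real) (case_sum (\<lambda>_. \<omega>) (\<lambda>_. \<xi>))"

lemma coord_law_simps:
  "coord_law (Inl y) = distr (measure_pmf q) borel real"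
  "coord_law (Inr (Inl yi)) = \<omega>"
  "coord_law (Inr (Inr y)) = \<xi>"
  by (simp_all add: coord_law_def)

lemma coord_law_push: "coord_law (push v j) = coord_law j"
  by (cases "(v, j)" rule: push.cases) (auto simp: coord_law_def)

lemma prob_space_coord_law: "prob_space (coord_law j)"
  using omega xi
  by (auto simp: coord_law_def real_distribution_def measure_pmf.prob_space_distr split: sum.split)

lemma sets_coord_law[simp, measurable_cong]: "sets (coord_law j) = sets borel"
  using omega xi
  by (auto simp: coord_law_def real_distribution_def real_distribution_axioms_def split: sum.split)

lemma space_coord_law[simp]: "space (coord_law j) = UNIV"
  using sets_eq_imp_space_eq[OF sets_coord_law] by simp

definition "P = PiM UNIV coord_law"

sublocale P: prob_space P
  unfolding P_def by (intro prob_space_PiM prob_space_coord_law)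

lemma sets_P[measurable_cong]: "sets P = sets coord_space"
  unfolding P_def by (intro sets_PiM_cong) auto

lemma space_P[simp]: "space P = UNIV"
  by (simp add: P_def space_PiM)

lemma indep_coords: "P.indep_vars (\<lambda>_. borel) (\<lambda>j \<zeta>. \<zeta> j) UNIV"
proof (subst P.indep_vars_iff_distr_eq_PiM')
  have "distr P (PiM UNIV (\<lambda>_. borel)) (\<lambda>\<zeta>. \<lambda>j\<in>UNIV. \<zeta> j) = distr P P (\<lambda>\<zeta>. \<zeta>)"
    by (intro distr_cong) (auto simp: sets_P)
  also have "\<dots> = PiM UNIV coord_law"
    by (simp add: distr_id2 P_def)
  also have "\<dots> = PiM UNIV (\<lambda>j. distr P borel (\<lambda>\<zeta>. \<zeta> j))"
  proof (intro PiM_cong refl)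
    fix j
    have "distr P borel (\<lambda>\<zeta>. \<zeta> j) = distr P (coord_law j) (\<lambda>\<zeta>. \<zeta> j)"
      by (intro distr_cong) auto
    then show "coord_law j = distr P borel (\<lambda>\<zeta>. \<zeta> j)"
      unfolding P_def by (simp add: distr_PiM_component prob_space_coord_law)
  qed
  finally show "distr P (PiM UNIV (\<lambda>_. borel)) (\<lambda>\<zeta>. \<lambda>j\<in>UNIV. \<zeta> j) = PiM UNIV (\<lambda>j. distr P borel (\<lambda>\<zeta>. \<zeta> j))" .
qed (auto simp: measurable_cong_sets[OF sets_P refl])

lemma distr_coord: "distr P borel (\<lambda>\<zeta>. \<zeta> j) = coord_law j"
proof -
  have "distr P borel (\<lambda>\<zeta>. \<zeta> j) = distr P (coord_law j) (\<lambda>\<zeta>. \<zeta> j)"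
    by (intro distr_cong) auto
  then show ?thesis
    unfolding P_def by (simp add: distr_PiM_component prob_space_coord_law)
qed

lemma measurable_subtree[measurable]: "subtree v \<in> measurable P coord_space"
proof -
  have "(\<lambda>\<zeta>. \<lambda>j\<in>UNIV. \<zeta> (push v j)) \<in> measurable P coord_space"
    by (intro measurable_restrict) measurable
  then show ?thesis by (simp add: subtree_def[abs_def] restrict_UNIV)
qed

text \<open>Self-similarity: \<open>push v\<close> is injective and preserves the coordinate laws,
  so selecting coordinates along it reproduces the product law.\<close>

lemma distr_subtree: "distr P coord_space (subtree v) = P"
proof -
  have "distr (PiM UNIV coord_law) (PiM UNIV (\<lambda>j. coord_law (push v j))) (\<lambda>\<zeta>. \<lambda>j\<in>UNIV. \<zeta> (push v j)) =
      PiM UNIV (\<lambda>j. coord_law (push v j))"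
    by (rule distr_PiM_reindex) (auto intro!: injI prob_space_coord_law dest: push_inject)
  then have "distr P P (subtree v) = P"
    by (simp add: coord_law_push P_def subtree_def[abs_def] restrict_UNIV)
  moreover have "distr P coord_space (subtree v) = distr P P (subtree v)"
    by (intro distr_cong) (auto simp: sets_P)
  ultimately show ?thesis by simp
qed

definition "\<Lambda> m = distr P (borel \<Otimes>\<^sub>M borel) (bounds_pair m)"

lemma measurable_bounds_pair_P[measurable]: "bounds_pair m \<in> measurable P (borel \<Otimes>\<^sub>M borel)"
  by (subst measurable_cong_sets[OF sets_P refl]) measurable

text \<open>The weight of the edge to a child and the bounds of the child's subtree read disjoint
  sets of coordinates, hence are independent.\<close>

lemma distr_child:
  "distr P (borel \<Otimes>\<^sub>M (borel \<Otimes>\<^sub>M borel)) (\<lambda>\<zeta>. (edge_weight \<zeta> [] i, bounds_pair m (subtree [i] \<zeta>))) = \<omega> \<Otimes>\<^sub>M \<Lambda> m"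
proof -
  let ?e = "Inr (Inl ([], i)) :: coord"
  have "P.indep_var (PiM {?e} (\<lambda>_. borel)) (\<lambda>\<zeta>. restrict (\<lambda>j. \<zeta> j) {?e})
      (PiM (range (push [i])) (\<lambda>_. borel)) (\<lambda>\<zeta>. restrict (\<lambda>j. \<zeta> j) (range (push [i])))"
    by (rule P.indep_var_restrict[OF indep_coords]) (auto elim!: push.elims[OF sym])
  moreover have "(\<lambda>\<eta>. \<eta> ?e) \<in> borel_measurable (PiM {?e} (\<lambda>_. borel))"
    by (rule measurable_component_singleton) simp
  moreover have "(\<lambda>\<eta>. bounds_pair m (subtree [i] \<eta>)) \<in> measurable (PiM (range (push [i])) (\<lambda>_. borel)) (borel \<Otimes>\<^sub>M borel)"
  proof -
    have "(\<lambda>\<eta>. \<lambda>j\<in>UNIV. \<eta> (push [i] j)) \<in> measurable (PiM (range (push [i])) (\<lambda>_. borel)) coord_space"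
      by (intro measurable_restrict measurable_component_singleton) auto
    then show ?thesis
      unfolding subtree_def by (intro measurable_compose[OF _ measurable_bounds_pair]) (simp add: restrict_UNIV)
  qed
  ultimately have "distr P borel (\<lambda>\<zeta>. edge_weight \<zeta> [] i) \<Otimes>\<^sub>M
      distr P (borel \<Otimes>\<^sub>M borel) (\<lambda>\<zeta>. bounds_pair m (subtree [i] \<zeta>)) =
      distr P (borel \<Otimes>\<^sub>M (borel \<Otimes>\<^sub>M borel)) (\<lambda>\<zeta>. (edge_weight \<zeta> [] i, bounds_pair m (subtree [i] \<zeta>)))"
  proof -
    let ?A = "PiM {?e} (\<lambda>_. borel :: real measure)" and ?B = "PiM (range (push [i])) (\<lambda>_. borel :: real measure)"
    let ?f = "\<lambda>\<eta> :: coord \<Rightarrow> real. \<eta> ?e" and ?g = "\<lambda>\<eta>. bounds_pair m (subtree [i] \<eta>)"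
    let ?R = "\<lambda>I \<zeta>. restrict (\<lambda>j. \<zeta> j :: real) I"
    assume ind: "P.indep_var ?A (?R {?e}) ?B (?R (range (push [i])))"
      and f: "?f \<in> borel_measurable ?A" and g: "?g \<in> measurable ?B (borel \<Otimes>\<^sub>M borel)"
    have R: "?R {?e} \<in> measurable P ?A" "?R (range (push [i])) \<in> measurable P ?B"
      and eq: "distr P ?A (?R {?e}) \<Otimes>\<^sub>M distr P ?B (?R (range (push [i]))) =
        distr P (?A \<Otimes>\<^sub>M ?B) (\<lambda>\<zeta>. (?R {?e} \<zeta>, ?R (range (push [i])) \<zeta>))"
      using ind by (auto simp: P.indep_var_distribution_eq)
    have fd: "distr P borel (\<lambda>\<zeta>. edge_weight \<zeta> [] i) = distr (distr P ?A (?R {?e})) borel ?f"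
      using R(1) f by (subst distr_distr) (simp_all add: o_def edge_weight_def)
    have gd: "distr P (borel \<Otimes>\<^sub>M borel) (\<lambda>\<zeta>. bounds_pair m (subtree [i] \<zeta>)) =
        distr (distr P ?B (?R (range (push [i])))) (borel \<Otimes>\<^sub>M borel) ?g"
      using R(2) g by (subst distr_distr) (simp_all add: o_def subtree_def)
    have "prob_space (distr P (borel \<Otimes>\<^sub>M borel) (\<lambda>\<zeta>. bounds_pair m (subtree [i] \<zeta>)))"
      by (rule P.prob_space_distr) measurable
    then have sf: "sigma_finite_measure (distr (distr P ?B (?R (range (push [i])))) (borel \<Otimes>\<^sub>M borel) ?g)"
      unfolding gd by (simp add: prob_space_imp_sigma_finite)
    have "distr (distr P ?A (?R {?e})) borel ?f \<Otimes>\<^sub>M distr (distr P ?B (?R (range (push [i])))) (borel \<Otimes>\<^sub>M borel) ?g =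
        distr (distr P (?A \<Otimes>\<^sub>M ?B) (\<lambda>\<zeta>. (?R {?e} \<zeta>, ?R (range (push [i])) \<zeta>)))
          (borel \<Otimes>\<^sub>M (borel \<Otimes>\<^sub>M borel)) (\<lambda>(\<eta>, \<eta>'). (?f \<eta>, ?g \<eta>'))"
      using f g sf by (subst pair_measure_distr) (simp_all add: eq)
    also have "\<dots> = distr P (borel \<Otimes>\<^sub>M (borel \<Otimes>\<^sub>M borel))
        ((\<lambda>(\<eta>, \<eta>'). (?f \<eta>, ?g \<eta>')) \<circ> (\<lambda>\<zeta>. (?R {?e} \<zeta>, ?R (range (push [i])) \<zeta>)))"
    proof (rule distr_distr)
      show "(\<lambda>(\<eta>, \<eta>'). (?f \<eta>, ?g \<eta>')) \<in> measurable (?A \<Otimes>\<^sub>M ?B) (borel \<Otimes>\<^sub>M (borel \<Otimes>\<^sub>M borel))"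
        unfolding split_beta' using f g
        by (intro measurable_Pair measurable_compose[OF measurable_fst] measurable_compose[OF measurable_snd])
      show "(\<lambda>\<zeta>. (?R {?e} \<zeta>, ?R (range (push [i])) \<zeta>)) \<in> measurable P (?A \<Otimes>\<^sub>M ?B)"
        using R by (rule measurable_Pair)
    qed
    finally show ?thesis
      unfolding fd gd by (simp add: o_def edge_weight_def subtree_def)
  qed
  moreover have "distr P borel (\<lambda>\<zeta>. edge_weight \<zeta> [] i) = \<omega>"
    unfolding edge_weight_def distr_coord by (simp add: coord_law_def)
  moreover have "distr P (borel \<Otimes>\<^sub>M borel) (\<lambda>\<zeta>. bounds_pair m (subtree [i] \<zeta>)) = \<Lambda> m"
  proof -
    have "distr (distr P coord_space (subtree [i])) (borel \<Otimes>\<^sub>M borel) (bounds_pair m) =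
        distr P (borel \<Otimes>\<^sub>M borel) (bounds_pair m \<circ> subtree [i])"
      by (rule distr_distr) measurable
    then show ?thesis by (simp add: distr_subtree \<Lambda>_def o_def)
  qed
  ultimately show ?thesis by simp
qed

lemma distr_offspring: "P.prob {\<zeta>. offspring \<zeta> y = k} = pmf q k"
proof -
  have "P.prob {\<zeta>. offspring \<zeta> y = k} = measure (distr P borel (\<lambda>\<zeta>. \<zeta> (Inl y))) {r. nat \<lfloor>r\<rfloor> = k}"
    by (subst measure_distr) (auto simp: offspring_def vimage_def)
  also have "\<dots> = measure (distr (measure_pmf q) borel real) {r. nat \<lfloor>r\<rfloor> = k}"
    by (simp only: distr_coord) (simp add: coord_law_def)
  also have "\<dots> = measure (measure_pmf q) {k}"
    by (subst measure_distr) (auto simp: vimage_def)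
  finally show ?thesis by (simp add: measure_pmf_single)
qed

text \<open>Disjoint groups of coordinates, one for each independent ingredient of the recursion at
  the root; block \<open>i + 2\<close> belongs to child \<open>i\<close>.\<close>

fun block :: "nat \<Rightarrow> coord set" where
  "block 0 = {Inl []}"
| "block (Suc 0) = {Inr (Inr [])}"
| "block (Suc (Suc i)) = insert (Inr (Inl ([], i))) (range (push [i]))"

lemma push_single_ne:
  "push [i] j \<noteq> Inl []" "push [i] j \<noteq> Inr (Inr [])" "push [i] j \<noteq> Inr (Inl ([], i'))"
  by (cases "([i], j)" rule: push.cases; auto)+

lemma disjoint_blocks: "disjoint_family block"
proof -
  have "block (Suc (Suc i)) \<inter> block (Suc (Suc i')) = {}" if "i \<noteq> i'" for i i'
    using that by (auto simp: push_single_ne push_single_ne[symmetric] dest: push_inject)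
  moreover have "block 0 \<inter> block (Suc i) = {}" "block (Suc 0) \<inter> block (Suc (Suc i)) = {}" for i
    by (cases i; auto simp: push_single_ne push_single_ne[symmetric])+
  ultimately show ?thesis
    unfolding disjoint_family_on_def
    by (metis Int_commute block.cases)
qed

text \<open>Once the offspring number is fixed to \<open>k\<close>, the event is an intersection of
  events depending on the first \<open>k + 2\<close> blocks, one each, and factorizes.\<close>

lemma joint:
  assumes A[measurable]: "A \<in> sets borel" and B[measurable]: "B \<in> sets (borel \<Otimes>\<^sub>M (borel \<Otimes>\<^sub>M borel))"
  shows "P.prob {\<zeta> \<in> space P. offspring \<zeta> [] = k \<and> vertex_weight \<zeta> [] \<in> A \<and>
      (\<forall>i<k. (edge_weight \<zeta> [] i, bounds_pair m (subtree [i] \<zeta>)) \<in> B)} =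
    pmf q k * measure \<xi> A * measure (\<omega> \<Otimes>\<^sub>M \<Lambda> m) B ^ k"
proof -
  define E where "E j = (case j of 0 \<Rightarrow> (\<lambda>\<zeta>. offspring \<zeta> [] = k) | Suc 0 \<Rightarrow> (\<lambda>\<zeta>. vertex_weight \<zeta> [] \<in> A)
    | Suc (Suc i) \<Rightarrow> (\<lambda>\<zeta>. (edge_weight \<zeta> [] i, bounds_pair m (subtree [i] \<zeta>)) \<in> B))" for j
  let ?N = "\<lambda>j. PiM (block j) (\<lambda>_. borel :: real measure)"
  let ?R = "\<lambda>j \<zeta>. restrict (\<lambda>i. \<zeta> i) (block j)"
  have ind: "P.indep_vars ?N ?R UNIV"
    by (rule P.indep_vars_restrict[OF indep_coords _ disjoint_blocks]) auto
  have meas: "Measurable.pred (?N j) (E j)" for j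
  proof (cases j rule: block.cases)
    case 1
    have "(\<lambda>\<eta>. \<eta> (Inl [])) \<in> borel_measurable (?N j)"
      by (rule measurable_component_singleton) (simp add: 1)
    then have "(\<lambda>\<eta>. nat \<lfloor>\<eta> (Inl [])\<rfloor>) \<in> measurable (?N j) (count_space UNIV)"
      by measurable
    then show ?thesis by (simp add: E_def 1 offspring_def)
  next
    case 2
    have "(\<lambda>\<eta>. \<eta> (Inr (Inr []))) \<in> borel_measurable (?N j)"
      by (rule measurable_component_singleton) (simp add: 2)
    then show ?thesis by (simp add: E_def 2 vertex_weight_def)
  next
    case (3 i)
    have "(\<lambda>\<eta>. \<eta> (Inr (Inl ([], i)))) \<in> borel_measurable (?N j)"
      by (rule measurable_component_singleton) (simp add: 3)
    moreover have "(\<lambda>\<eta>. \<lambda>l\<in>UNIV. \<eta> (push [i] l)) \<in> measurable (?N j) coord_space"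
      by (intro measurable_restrict measurable_component_singleton) (auto simp: 3)
    then have "(\<lambda>\<eta>. bounds_pair m (subtree [i] \<eta>)) \<in> measurable (?N j) (borel \<Otimes>\<^sub>M borel)"
      unfolding subtree_def by (intro measurable_compose[OF _ measurable_bounds_pair]) (simp add: restrict_UNIV)
    ultimately have "(\<lambda>\<eta>. (\<eta> (Inr (Inl ([], i))), bounds_pair m (subtree [i] \<eta>)))
        \<in> measurable (?N j) (borel \<Otimes>\<^sub>M (borel \<Otimes>\<^sub>M borel))"
      by (rule measurable_Pair)
    then show ?thesis
      using B by (simp add: E_def 3 edge_weight_def)
  qed
  \<comment> \<open>Each event reads only the coordinates in its own block, so restricting the
    sample does not change it.\<close>
  have local: "E j (?R j \<zeta>) = E j \<zeta>" for j \<zeta>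
    by (cases j rule: block.cases)
      (simp_all add: E_def offspring_def vertex_weight_def edge_weight_def subtree_def)
  have pre: "?R j -` {\<eta> \<in> space (?N j). E j \<eta>} \<inter> space P = {\<zeta>. E j \<zeta>}" for j
    using local by (auto simp: space_PiM)
  have "P.prob (\<Inter>j\<in>{..<Suc (Suc k)}. ?R j -` {\<eta> \<in> space (?N j). E j \<eta>} \<inter> space P) =
      (\<Prod>j\<in>{..<Suc (Suc k)}. P.prob (?R j -` {\<eta> \<in> space (?N j). E j \<eta>} \<inter> space P))"
    by (rule P.indep_varsD_finite[OF P.indep_vars_subset[OF ind]]) (use meas in \<open>auto simp: pred_def\<close>)
  then have eq: "P.prob (\<Inter>j\<in>{..<Suc (Suc k)}. {\<zeta>. E j \<zeta>}) = (\<Prod>j\<in>{..<Suc (Suc k)}. P.prob {\<zeta>. E j \<zeta>})"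
    unfolding pre .
  have "(\<Inter>j\<in>{..<Suc (Suc k)}. {\<zeta>. E j \<zeta>}) = {\<zeta> \<in> space P. offspring \<zeta> [] = k \<and> vertex_weight \<zeta> [] \<in> A \<and>
      (\<forall>i<k. (edge_weight \<zeta> [] i, bounds_pair m (subtree [i] \<zeta>)) \<in> B)}"
    by (auto simp: lessThan_Suc_eq_insert_0 E_def image_image)
  moreover have "P.prob {\<zeta>. E 0 \<zeta>} = pmf q k"
    by (simp add: E_def distr_offspring)
  moreover have "P.prob {\<zeta>. E (Suc 0) \<zeta>} = measure \<xi> A"
  proof -
    have "P.prob {\<zeta>. E (Suc 0) \<zeta>} = measure (distr P borel (\<lambda>\<zeta>. \<zeta> (Inr (Inr [])))) A"
      by (subst measure_distr) (auto simp: E_def vertex_weight_def vimage_def)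
    then show ?thesis by (simp only: distr_coord) (simp add: coord_law_def)
  qed
  moreover have "P.prob {\<zeta>. E (Suc (Suc i)) \<zeta>} = measure (\<omega> \<Otimes>\<^sub>M \<Lambda> m) B" for i
    unfolding distr_child[of i m, symmetric] by (subst measure_distr) (auto simp: E_def vimage_def)
  ultimately show ?thesis
    using eq by (simp add: prod.lessThan_Suc_shift mult.assoc del: prod.lessThan_Suc)
qed

end

lemma AE_subtree_bounds_coincide:
  assumes "real_distribution \<omega>" "real_distribution \<xi>"
    and bdd: "bdd_below (measure_support \<xi>)"
    and atom: "atomless \<omega>" and conv: "locally_convex_under_max \<omega>"
  shows "AE \<zeta> in subtree_law.P q \<omega> \<xi>. Lo (law_min \<xi>) \<zeta> = Up (law_min \<xi>) \<zeta>"
proof -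
  interpret subtree_law q \<omega> \<xi> by (rule subtree_law.intro[OF assms(1,2)])
  let ?m = "law_min \<xi>"
  obtain a where a: "ereal a < law_max \<omega>" "{t. a < t \<and> ereal t < law_max \<omega>} \<subseteq> measure_support \<omega>"
    using conv by (auto simp: locally_convex_under_max_def)
  have "AE \<zeta> in P. ?m \<le> vertex_weight \<zeta> v" for v
    unfolding P_def vertex_weight_def
    by (rule AE_PiM_component[OF prob_space_coord_law UNIV_I])
      (unfold coord_law_simps, rule law_min_le[OF xi bdd])
  then have m: "AE \<zeta> in P. \<forall>v. ?m \<le> vertex_weight \<zeta> v"
    by (simp add: AE_all_countable)
  have "coupled_recursion P q \<omega> \<xi> ?m a (law_max \<omega>) (\<Lambda> ?m) (\<lambda>\<zeta>. offspring \<zeta> [])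
    (\<lambda>\<zeta>. vertex_weight \<zeta> []) (\<lambda>i \<zeta>. edge_weight \<zeta> [] i) (\<lambda>i \<zeta>. bounds_pair ?m (subtree [i] \<zeta>))
    (bounds_pair ?m)"
  proof (intro coupled_recursion.intro coupled_recursion_axioms.intro)
    show "\<Lambda> ?m = distr P (borel \<Otimes>\<^sub>M borel) (bounds_pair ?m)" by (simp add: \<Lambda>_def)
    show "AE \<zeta> in P. fst (bounds_pair ?m \<zeta>) = Max (insert (vertex_weight \<zeta> [])
        ((\<lambda>i. edge_weight \<zeta> [] i - snd (bounds_pair ?m (subtree [i] \<zeta>))) ` {..<offspring \<zeta> []}))"
      using m by eventually_elim (rule bounds_pair_rec, blast)
    show "AE \<zeta> in P. snd (bounds_pair ?m \<zeta>) = Max (insert (vertex_weight \<zeta> [])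
        ((\<lambda>i. edge_weight \<zeta> [] i - fst (bounds_pair ?m (subtree [i] \<zeta>))) ` {..<offspring \<zeta> []}))"
      using m by eventually_elim (rule bounds_pair_rec, blast)
    have "AE \<zeta> in P. ?m \<le> fst (bounds_pair ?m \<zeta>) \<and> fst (bounds_pair ?m \<zeta>) \<le> snd (bounds_pair ?m \<zeta>)"
      using m by eventually_elim (blast intro: bounds_pair_ge bounds_pair_le)
    then show "AE z in \<Lambda> ?m. ?m \<le> fst z \<and> fst z \<le> snd z"
      unfolding \<Lambda>_def by (subst AE_distr_iff) auto
  qed (use P.prob_space_axioms omega xi joint atom a law_min_le[OF xi bdd] measure_near_law_min[OF xi bdd] le_law_max[OF omega]
      measure_interval_pos[OF a(2)] in \<open>auto simp: atomless_def\<close>)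
  then have "AE z in \<Lambda> ?m. fst z = snd z"
    by (rule coupled_recursion.AE_bounds_coincide)
  then have "AE \<zeta> in P. fst (bounds_pair ?m \<zeta>) = snd (bounds_pair ?m \<zeta>)"
    unfolding \<Lambda>_def by (subst (asm) AE_distr_iff) auto
  with m show ?thesis
  proof eventually_elim
    case (elim \<zeta>)
    then show ?case
      by (metis ereal_fst_bounds_pair ereal_snd_bounds_pair)
  qed
qed


section \<open>The subtrees of the random tree\<close>

context weighted_ubgw
begin

definition subtree_coords :: "vertex \<Rightarrow> 's \<Rightarrow> coord \<Rightarrow> real" where
  "subtree_coords v s = case_sum (\<lambda>y. real (N (v @ y) s))
    (case_sum (\<lambda>(y, i). w {v @ y, v @ y @ [i]} s) (\<lambda>y. x (v @ y) s))"

text \<open>In the ambient family an edge is an unordered pair. Its parent is recovered as the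
  shorter word, so distinct coordinates receive distinct indices.\<close>

definition global_index :: "vertex \<Rightarrow> coord \<Rightarrow> vertex + vertex set + vertex" where
  "global_index v = case_sum (\<lambda>y. Inl (v @ y))
    (case_sum (\<lambda>(y, i). Inr (Inl {v @ y, v @ y @ [i]})) (\<lambda>y. Inr (Inr (v @ y))))"

lemma edge_inject: "{y, y @ [i]} = {z, z @ [j]} \<Longrightarrow> y = z \<and> i = j" for y z :: vertex
  by (auto simp: doubleton_eq_iff)

lemma inj_global_index: "inj (global_index v)"
proof (rule injI)
  fix j j' assume "global_index v j = global_index v j'"
  then show "j = j'"
    using edge_inject[of "v @ y" i "v @ y'" i' for y i y' i']
    by (auto simp: global_index_def split: sum.splits prod.splits)
qed

lemma edge_in_uh_edges: "{y, y @ [i]} \<in> uh_edges"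
  by (auto simp: uh_edges_def uh_adjacent_def)

lemma global_index_in: "global_index v j \<in> UNIV <+> uh_edges <+> UNIV"
  by (auto simp: global_index_def edge_in_uh_edges[of "v @ y" for y, simplified] split: sum.splits prod.splits)

text \<open>The coordinates below \<open>v\<close> are an injective selection from the independent
  family. Since \<open>v\<close> is not the root, every offspring number among them is
  size-biased.\<close>

lemma distr_subtree_coords:
  assumes "v \<noteq> []"
  shows "subtree_coords v \<in> measurable M coord_space"
    and "distr M coord_space (subtree_coords v) = subtree_law.P (size_biased \<pi>) \<omega> \<xi>"
proof -
  interpret L: subtree_law "size_biased \<pi>" \<omega> \<xi>
    by (rule subtree_law.intro[OF edge_law vertex_law])
  let ?X = "case_sum (\<lambda>v s. real (N v s)) (case_sum w x)" and ?I = "UNIV <+> uh_edges <+> UNIV"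
  let ?D = "\<lambda>i. distr M borel (?X i)"
  have rv: "random_variable borel (?X i)" if "i \<in> ?I" for i
    using independent that by (auto simp: indep_vars_def)
  have "?I \<noteq> {}" by auto
  then have joint_law: "distr M (PiM ?I (\<lambda>_. borel)) (\<lambda>s. \<lambda>i\<in>?I. ?X i s) = PiM ?I ?D"
    using independent rv by (subst (asm) indep_vars_iff_distr_eq_PiM') auto
  have coords: "subtree_coords v s j = ?X (global_index v j) s" for s j
    by (auto simp: subtree_coords_def global_index_def split: sum.splits prod.splits)
  have law: "?D (global_index v j) = L.coord_law j" for j
  proof (cases j)
    case (Inl y)
    have "distr M borel (\<lambda>s. real (N (v @ y) s)) = distr (distr M (count_space UNIV) (N (v @ y))) borel real"
      using N_nonroot(1)[of "v @ y"] assms by (subst distr_distr) (auto simp: o_def)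
    then show ?thesis
      using N_nonroot(2)[of "v @ y"] assms by (simp add: Inl global_index_def L.coord_law_def)
  next
    case (Inr j')
    show ?thesis
    proof (cases j')
      case (Inl yi)
      then show ?thesis
        using w_dist(2)[OF edge_in_uh_edges]
        by (auto simp: Inr global_index_def L.coord_law_def split: prod.split simp flip: append_assoc)
    next
      case (Inr y)
      then show ?thesis
        using x_dist(2) by (simp add: \<open>j = Inr j'\<close> global_index_def L.coord_law_def)
    qed
  qed
  show meas: "subtree_coords v \<in> measurable M coord_space"
  proof -
    have "(\<lambda>s. \<lambda>j\<in>UNIV. ?X (global_index v j) s) \<in> measurable M coord_space"
      by (intro measurable_restrict rv global_index_in)
    moreover have "(\<lambda>s. \<lambda>j\<in>UNIV. ?X (global_index v j) s) = subtree_coords v"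
      by (simp add: coords fun_eq_iff)
    ultimately show ?thesis by simp
  qed
  let ?r = "\<lambda>\<eta>. \<lambda>j\<in>UNIV. \<eta> (global_index v j)"
  have "distr (PiM ?I ?D) (PiM UNIV (\<lambda>j. ?D (global_index v j))) ?r = PiM UNIV (\<lambda>j. ?D (global_index v j))"
    by (rule distr_PiM_reindex) (use inj_global_index global_index_in in \<open>blast intro: prob_space_distr rv\<close>)+
  then have "distr (PiM ?I ?D) L.P ?r = L.P"
    by (simp only: law L.P_def)
  also have "distr (PiM ?I ?D) L.P ?r = distr (PiM ?I ?D) coord_space ?r"
    by (intro distr_cong) (auto simp: L.sets_P)
  also have "\<dots> = distr M coord_space (?r \<circ> (\<lambda>s. \<lambda>i\<in>?I. ?X i s))"
    unfolding joint_law[symmetric]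
  proof (rule distr_distr)
    show "?r \<in> measurable (PiM ?I (\<lambda>_. borel)) coord_space"
      by (intro measurable_restrict measurable_component_singleton global_index_in)
    show "(\<lambda>s. \<lambda>i\<in>?I. ?X i s) \<in> measurable M (PiM ?I (\<lambda>_. borel))"
      by (intro measurable_restrict rv)
  qed
  also have "?r \<circ> (\<lambda>s. \<lambda>i\<in>?I. ?X i s) = subtree_coords v"
    using global_index_in by (simp add: coords fun_eq_iff)
  finally show "distr M coord_space (subtree_coords v) = L.P" .
qed

text \<open>There are countably many words, so the almost sure equalities hold simultaneously.
  Quantifying over all words avoids conditioning on which of them belong to the random tree.\<close>

lemma AE_coinciding_bounds:
  assumes bdd: "bdd_below (measure_support \<xi>)" and "atomless \<omega>" "locally_convex_under_max \<omega>"
  shows "AE s in M. coinciding_bounds (\<lambda>v. N v s) (\<lambda>e. w e s) (\<lambda>v. x v s) (law_min \<xi>)"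
proof -
  let ?m = "law_min \<xi>"
  have "AE s in M. ?m \<le> x v s" for v
  proof -
    have "AE t in distr M borel (x v). ?m \<le> t"
      unfolding x_dist(2) by (rule law_min_le[OF vertex_law bdd])
    then show ?thesis by (rule AE_distrD[OF x_dist(1)])
  qed
  then have ge: "AE s in M. \<forall>v. ?m \<le> x v s"
    by (simp add: AE_all_countable)
  have "AE s in M. v \<noteq> [] \<longrightarrow> Lo ?m (subtree_coords v s) = Up ?m (subtree_coords v s)" for v
  proof (cases "v = []")
    case False
    have "AE \<zeta> in distr M coord_space (subtree_coords v). Lo ?m \<zeta> = Up ?m \<zeta>"
      unfolding distr_subtree_coords(2)[OF False]
      by (rule AE_subtree_bounds_coincide[OF edge_law vertex_law assms])
    then show ?thesis
      by (auto dest!: AE_distrD[OF distr_subtree_coords(1)[OF False]] elim!: eventually_mono)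
  qed simp
  then have "AE s in M. \<forall>v. v \<noteq> [] \<longrightarrow> Lo ?m (subtree_coords v s) = Up ?m (subtree_coords v s)"
    by (simp add: AE_all_countable)
  with ge show ?thesis
  proof eventually_elim
    case (elim s)
    have *: "offspring (subtree_coords v s) = (\<lambda>y. N (v @ y) s)"
      "edge_weight (subtree_coords v s) = (\<lambda>y i. w {v @ y, (v @ y) @ [i]} s)"
      "vertex_weight (subtree_coords v s) = (\<lambda>y. x (v @ y) s)" for v
      by (auto simp: fun_eq_iff offspring_def edge_weight_def vertex_weight_def subtree_coords_def)
    show ?case
    proof
      fix v :: vertex assume "v \<noteq> []"
      then show "lower_limit (\<lambda>v. N v s) (\<lambda>v i. w {v, v @ [i]} s) (\<lambda>v. x v s) ?m v =
        upper_limit (\<lambda>v. N v s) (\<lambda>v i. w {v, v @ [i]} s) (\<lambda>v. x v s) ?m v"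
        using elim(2)
          lower_limit_shift[of "\<lambda>v. N v s" "\<lambda>v i. w {v, v @ [i]} s" "\<lambda>v. x v s" ?m v "[]"]
          upper_limit_shift[of "\<lambda>v. N v s" "\<lambda>v i. w {v, v @ [i]} s" "\<lambda>v. x v s" ?m v "[]"]
        by (simp add: Lo_def Up_def *)
    qed (use elim(1) in auto)
  qed
qed

end

theorem proposition4p1:
  fixes M :: "'s measure" and \<pi> :: "nat pmf" and \<omega> \<xi> :: "real measure"
    and N :: "vertex \<Rightarrow> 's \<Rightarrow> nat"
    and w :: "vertex set \<Rightarrow> 's \<Rightarrow> real"
    and x :: "vertex \<Rightarrow> 's \<Rightarrow> real"
  assumes ubgw: "weighted_ubgw M \<pi> \<omega> \<xi> N w x"
    and vertex_law_bdd: "bdd_below (measure_support \<xi>)"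
    and vertex_law_atoms:
      "atomless \<xi> \<or>
       measure \<xi> {law_min \<xi>} > 0 \<and> (\<forall>a. a \<noteq> law_min \<xi> \<longrightarrow> measure \<xi> {a} = 0)"
    and edge_law_atomless: "atomless \<omega>"
    and edge_law_convex: "locally_convex_under_max \<omega>"
    and second_moment: "integrable (measure_pmf \<pi>) (\<lambda>k. (real k)\<^sup>2)"
  shows "\<exists>Z :: vertex \<Rightarrow> vertex \<Rightarrow> 's \<Rightarrow> ereal.
    (\<forall>u v. Z u v \<in> borel_measurable (weighted_tree_sigma M N w x)) \<and>
    (AE s in M. \<forall>(u, v) \<in> directed_edges (sample_tree N s).
       (\<lambda>H. ball_messages (sample_tree N s) (\<lambda>e. w e s) (\<lambda>a. x a s) \<infinity> H u v)
         \<longlonglongrightarrow> Z u v s \<and>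
       (\<lambda>H. ball_messages (sample_tree N s) (\<lambda>e. w e s) (\<lambda>a. x a s) (ereal (law_min \<xi>)) H u v)
         \<longlonglongrightarrow> Z u v s) \<and>
    (AE s in M.
       is_message_family (sample_tree N s) (\<lambda>u v. Z u v s) \<and>
       satisfies_recursion (sample_tree N s) (\<lambda>e. w e s) (\<lambda>a. x a s) (\<lambda>u v. Z u v s) \<and>
       (\<forall>Y. is_message_family (sample_tree N s) Y \<longrightarrow>
            satisfies_recursion (sample_tree N s) (\<lambda>e. w e s) (\<lambda>a. x a s) Y \<longrightarrow>
            (\<forall>(u, v) \<in> directed_edges (sample_tree N s). Y u v = Z u v s)))"
proof -
  define Z where "Z u v s = ball_limit (sample_tree N s) (\<lambda>e. w e s) (\<lambda>a. x a s) u v" for u v s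
  have AE: "AE s in M. coinciding_bounds (\<lambda>v. N v s) (\<lambda>e. w e s) (\<lambda>v. x v s) (law_min \<xi>)"
    using weighted_ubgw.AE_coinciding_bounds[OF ubgw vertex_law_bdd edge_law_atomless edge_law_convex] .
  show ?thesis
  proof (intro exI[of _ Z] conjI allI)
    show "Z u v \<in> borel_measurable (weighted_tree_sigma M N w x)" for u v
      unfolding Z_def[abs_def] by (rule measurable_ball_limit)
    show "AE s in M. \<forall>(u, v) \<in> directed_edges (sample_tree N s).
       (\<lambda>H. ball_messages (sample_tree N s) (\<lambda>e. w e s) (\<lambda>a. x a s) \<infinity> H u v)
         \<longlonglongrightarrow> Z u v s \<and>
       (\<lambda>H. ball_messages (sample_tree N s) (\<lambda>e. w e s) (\<lambda>a. x a s) (ereal (law_min \<xi>)) H u v)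
         \<longlonglongrightarrow> Z u v s"
      using AE
    proof eventually_elim
      case (elim s)
      then interpret coinciding_bounds "\<lambda>v. N v s" "\<lambda>e. w e s" "\<lambda>v. x v s" "law_min \<xi>" .
      \<comment> \<open>The flag \<open>False\<close> selects the boundary value
        \<open>\<infinity>\<close>, and \<open>True\<close> selects
        \<open>law_min \<xi>\<close>.\<close>
      show ?case
        using ball_messages_tendsto[of _ _ False] ball_messages_tendsto[of _ _ True]
        by (auto simp: Z_def sample_tree_def)
    qed
    show "AE s in M.
       is_message_family (sample_tree N s) (\<lambda>u v. Z u v s) \<and>
       satisfies_recursion (sample_tree N s) (\<lambda>e. w e s) (\<lambda>a. x a s) (\<lambda>u v. Z u v s) \<and>
       (\<forall>Y. is_message_family (sample_tree N s) Y \<longrightarrow>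
            satisfies_recursion (sample_tree N s) (\<lambda>e. w e s) (\<lambda>a. x a s) Y \<longrightarrow>
            (\<forall>(u, v) \<in> directed_edges (sample_tree N s). Y u v = Z u v s))"
      using AE
    proof eventually_elim
      case (elim s)
      then interpret coinciding_bounds "\<lambda>v. N v s" "\<lambda>e. w e s" "\<lambda>v. x v s" "law_min \<xi>" .
      show ?case
        using ball_limit_is_message_family ball_limit_satisfies_recursion satisfies_recursion_unique
        by (auto simp: Z_def sample_tree_def)
    qed
  qed
qed

end
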